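(* In the setting described in the context, assume that for every $m\ge1$, every $x\in\mathcal X^{\mathbb N}$ and all $y,y'\in\mathcal Y$, $d(F_m(x;y),F_m(x;y'))\le\delta(y,y')$. Let $p\ge2$ and assume that there exist positive constants $V_k$ and $A_k(p)$ such that, for every $k\in[1,n]$, $$\mathbb E\big[(G_{\varepsilon_k}(\varepsilon_k))^2\big]\le V_k\qquad\text{and}\qquad \mathbb E\big[(G_{\varepsilon_k}(\varepsilon_k))^p\big]\le A_k(p).$$ Let $$V=\sum_{k=1}^n\big(a_{n-k}(n-k)\big)^2V_k,\qquad A(p)=\sum_{k=1}^n\big(a_{n-k}(n-k)\big)^pA_k(p).$$ Then, for every $x>0$, $$\mathbb P(|S_n|\ge x)\le2\Big(1+\frac2p\Big)^p\frac{A(p)}{x^p}+2\exp\Big(-\frac{2}{(p+2)^2e^p}\,\frac{x^2}{V}\Big).$$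
   Context: Let $(\mathcal X,d)$ and $(\mathcal Y,\delta)$ be complete separable metric spaces. Let $(\varepsilon_i)_{i\ge1}$ be independent (not necessarily identically distributed) $\mathcal Y$-valued random variables, with $P_{\varepsilon_k}$ the law of $\varepsilon_k$. Let $(X_i)_{i\le0}$ be a deterministic sequence in $\mathcal X$. For each $m\ge1$ let $F_m:\mathcal X^{\mathbb N}\times\mathcal Y\to\mathcal X$ be measurable, and define recursively $X_m=F_m((X_{m-i})_{i\ge1};\varepsilon_m)$ for $m\ge1$. Assume there are nonnegative numbers $a_i$, $i\ge1$, with $\sum_{i\ge1}a_i<1$, such that for all $m\ge1$ and all sequences $(x_{m-i})_{i\ge1},(x'_{m-i})_{i\ge1}$ in $\mathcal X$, $$\mathbb E\big[d\big(F_m((x_{m-i})_{i\ge1};\varepsilon_m),F_m((x'_{m-i})_{i\ge1};\varepsilon_m)\big)\big]\le\sum_{i=1}^\infty a_i\,d(x_{m-i},x'_{m-i}).$$ Fix $n\ge1$ and let $f:\mathcal X^n\to\mathbb R$ satisfy $|f(x_1,\ldots,x_n)-f(x'_1,\ldots,x'_n)|\le\sum_{i=1}^n d(x_i,x'_i)$. Put $S_n=f(X_1,\ldots,X_n)-\mathbb E[f(X_1,\ldots,X_n)]$. The numbers $a_k(k)$, $k\ge0$, are defined recursively by $a_0(0)=1$ and $a_k(k)=1+a_k+\sum_{l=1}^{k-1}a_l(l)\,a_{k-l}$ for $k\ge1$ (so $a_1(1)=1+a_1$). $G_{\varepsilon_k}(y)=\int\delta(y,y')\,P_{\varepsilon_k}(dy')$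 for $y\in\mathcal Y$. *)

theory Defs
  imports "HOL-Probability.Probability"
begin

text \<open>
  Infinite pasts \<open>(x\<^sub>m\<^sub>-\<^sub>i)\<^sub>i\<^sub>\<ge>\<^sub>1\<close> are functions on \<open>nat\<close> with
  position \<open>j\<close> holding \<open>x\<^sub>m\<^sub>-\<^sub>j\<^sub>-\<^sub>1\<close>, so \<open>a\<^sub>i\<close> weighs position \<open>i - 1\<close>.
  The coefficients \<open>a\<close> themselves keep their indices \<open>i \<ge> 1\<close>; the value \<open>a 0\<close> is never used.
\<close>

locale infinite_memory_chain = prob_space M for M :: "'w measure" +
  fixes \<epsilon> :: "nat \<Rightarrow> 'w \<Rightarrow> 'y::polish_space"
    and F :: "nat \<Rightarrow> (nat \<Rightarrow> 'x::polish_space) \<Rightarrow> 'y \<Rightarrow> 'x"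
    and a :: "nat \<Rightarrow> real"
    and past :: "int \<Rightarrow> 'x"
    and X :: "int \<Rightarrow> 'w \<Rightarrow> 'x"
  assumes indep_innovations: "indep_vars (\<lambda>_. borel) \<epsilon> {1..}"
    and F_measurable: "\<And>m. m \<ge> 1 \<Longrightarrow>
      (\<lambda>(x, y). F m x y) \<in> (\<Pi>\<^sub>M j\<in>UNIV. borel) \<Otimes>\<^sub>M borel \<rightarrow>\<^sub>M borel"
    and X_past: "\<And>i \<omega>. i \<le> 0 \<Longrightarrow> \<omega> \<in> space M \<Longrightarrow> X i \<omega> = past i"
    and X_step: "\<And>m \<omega>. m \<ge> 1 \<Longrightarrow> \<omega> \<in> space M \<Longrightarrow>
      X (int m) \<omega> = F m (\<lambda>j. X (int m - int (Suc j)) \<omega>) (\<epsilon> m \<omega>)"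
    and a_nonneg: "\<And>i. i \<ge> 1 \<Longrightarrow> 0 \<le> a i"
    and a_summable: "summable (\<lambda>j. a (Suc j))"
    and a_sum_less_1: "(\<Sum>j. a (Suc j)) < 1"
    \<comment> \<open>stated in \<open>ennreal\<close> because the right-hand side may be infinite\<close>
    and contraction: "\<And>m x x'. m \<ge> 1 \<Longrightarrow>
      (\<integral>\<^sup>+\<omega>. ennreal (dist (F m x (\<epsilon> m \<omega>)) (F m x' (\<epsilon> m \<omega>))) \<partial>M)
        \<le> (\<Sum>j. ennreal (a (Suc j) * dist (x j) (x' j)))"

text \<open>
  The space \<open>\<X>\<^sup>n\<close> is the set of extensional functions on \<open>{1..n}\<close>.
\<close>

definition separately_Lipschitz :: "nat \<Rightarrow> ((nat \<Rightarrow> 'x::metric_space) \<Rightarrow> real) \<Rightarrow> bool" where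
  "separately_Lipschitz n f \<longleftrightarrow>
     (\<forall>x \<in> {1..n} \<rightarrow>\<^sub>E UNIV. \<forall>x' \<in> {1..n} \<rightarrow>\<^sub>E UNIV.
        \<bar>f x - f x'\<bar> \<le> (\<Sum>i=1..n. dist (x i) (x' i)))"

definition centered_functional ::
  "'w measure \<Rightarrow> nat \<Rightarrow> ((nat \<Rightarrow> 'x) \<Rightarrow> real) \<Rightarrow> (int \<Rightarrow> 'w \<Rightarrow> 'x) \<Rightarrow> 'w \<Rightarrow> real" where
  "centered_functional M n f X \<omega> =
     f (\<lambda>i\<in>{1..n}. X (int i) \<omega>) - (\<integral>\<omega>'. f (\<lambda>i\<in>{1..n}. X (int i) \<omega>') \<partial>M)"

text \<open>\<open>diag_coeff a k\<close> is the number written \<open>a\<^sub>k(k)\<close>.\<close>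

fun diag_coeff :: "(nat \<Rightarrow> real) \<Rightarrow> nat \<Rightarrow> real" where
  "diag_coeff a 0 = 1"
| "diag_coeff a (Suc k) = 1 + a (Suc k) + (\<Sum>l=1..k. diag_coeff a l * a (Suc k - l))"

text \<open>
  \<open>G\<close> is \<open>ennreal\<close>-valued: a Bochner integral would be \<open>0\<close> where \<open>\<delta>(y, \<cdot>)\<close>
  is not integrable, and would make moment bounds on \<open>G\<close> vacuous there.
\<close>

definition mean_dist :: "'y::metric_space measure \<Rightarrow> 'y \<Rightarrow> ennreal" where
  "mean_dist P y = (\<integral>\<^sup>+y'. ennreal (dist y y') \<partial>P)"

definition ennreal_powr :: "ennreal \<Rightarrow> real \<Rightarrow> ennreal" where
  "ennreal_powr t p = (if t = \<infinity> then \<infinity> else ennreal (enn2real t powr p))"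

end

theory Submission
  imports Defs
begin

text \<open>
  Let \<open>g\<^sub>k\<close> be the conditional mean of \<open>f(X\<^sub>1, \<dots>, X\<^sub>n)\<close> as a function of the history at time \<open>k\<close>. Backward
  induction with the contraction property shows that \<open>g\<^sub>k\<close> is Lipschitz in the state at time \<open>k\<close> with
  constant \<open>a\<^sub>n\<^sub>-\<^sub>k(n - k)\<close>, so the martingale increment of \<open>S\<^sub>n\<close> at time \<open>k\<close> is dominated by
  \<open>a\<^sub>n\<^sub>-\<^sub>k(n - k) G(\<epsilon>\<^sub>k)\<close>, which is independent of the past. It remains to prove the Fuk--Nagaev inequality
  for such martingales: outside the event that some dominating variable exceeds \<open>c = p x / (p + 2)\<close>,
  the exponential moments factorize and are bounded by \<open>e\<^sup>u - 1 - u \<le> e\<^sup>p u\<^sup>2 / 2\<close> for \<open>u \<le> p\<close> and by the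
  monotonicity of \<open>(e\<^sup>u - 1 - u) / u\<^sup>p\<close> for \<open>u \<ge> p\<close>.
\<close>

section \<open>Elementary inequalities\<close>

text \<open>The threshold \<open>c\<close> splits \<open>x\<close> into \<open>c\<close> and
  \<open>x - c = 2 x / (p + 2)\<close>: the first makes \<open>A / c^p\<close> equal to
  \<open>(1 + 2/p)^p A / x^p\<close>, the second drives the Gaussian optimum and yields the constant
  \<open>2 / ((p + 2)^2 e^p)\<close>. The delicate point is the factor 2 of the polynomial term,
  which must pay both for the event that a dominating variable exceeds \<open>c\<close> and for the
  excess in the two exponential bounds. Bounding each by the full moment would not fit into it, so
  the part of the p-th moment above \<open>c\<close> is tracked separately throughout. Exponentials
  are multiplied by indicators while the increments themselves are not truncated, so these stay
  centered. Conditioning needs no sigma-algebras: the past is a tuple of innovations, conditional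
  means are iterated integrals over explicit histories, and independence acts through
  Fubini.\<close>

lemma exp_remainder_le_square:
  fixes u q :: real
  assumes "u \<le> q" "0 \<le> q"
  shows "exp u - 1 - u \<le> exp q * u\<^sup>2 / 2"
proof -
  obtain t where t: "\<bar>t\<bar> \<le> \<bar>u\<bar>" "exp u = (\<Sum>m<2. u ^ m / fact m) + exp t / fact 2 * u ^ 2"
    using Maclaurin_exp_le[of u 2] by blast
  show ?thesis
  proof (cases "u \<le> 0")
    case True
    have "exp u - 1 - u \<le> u\<^sup>2 / 2"
    proof -
      \<comment> \<open>The point \<open>t\<close> obtained above only satisfies
        \<open>\<bar>t\<bar> \<le> \<bar>u\<bar>\<close>, which for negative \<open>u\<close> would
        allow \<open>exp t > 1\<close>; here the intermediate point is itself negative.\<close>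
      have "\<exists>t. u < t \<and> t < 0 \<and> exp u = (\<Sum>m<2. exp 0 / fact m * u ^ m) + exp t / fact 2 * u ^ 2" if "u < 0"
        by (rule Maclaurin_minus[where diff = "\<lambda>_. exp"]) (use that in auto)
      then show ?thesis
        using True
        by (cases "u = 0") (force simp: lessThan_Suc numeral_2_eq_2 mult_left_le_one_le)+
    qed
    also have "\<dots> \<le> exp q * u\<^sup>2 / 2"
      using assms by (simp add: mult_le_cancel_right1)
    finally show ?thesis .
  next
    case False
    then have "exp t \<le> exp q" using t(1) assms by auto
    then have "exp t * u\<^sup>2 \<le> exp q * u\<^sup>2" by (intro mult_right_mono) auto
    then show ?thesis using t(2) by (simp add: lessThan_Suc numeral_2_eq_2)
  qed
qed

text \<open>With \<open>r = z / u\<close>, the inequality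
  \<open>p * ln r \<le> u * (r - 1) = z - u\<close> controls the exponential, while
  \<open>r powr p\<close> outgrows the linear part \<open>1 + u\<close>; subtracting the two
  estimates avoids any derivative.\<close>

lemma exp_remainder_scaling:
  fixes p u z :: real
  assumes "1 \<le> p" "p \<le> u" "u \<le> z"
  shows "exp u - 1 - u \<le> (exp z - 1 - z) * (u / z) powr p"
proof -
  have pos: "0 < u" "0 < z" using assms by auto
  define r where "r = z / u"
  have r: "1 \<le> r" "0 < r" using assms pos by (auto simp: r_def)
  have "p * ln r \<le> u * ln r"
    using assms r by (intro mult_right_mono) auto
  also have "\<dots> \<le> u * (r - 1)"
    using r pos by (intro mult_left_mono ln_le_minus_one) auto
  also have "\<dots> = z - u" using pos by (simp add: r_def field_simps)
  finally have "r powr p * exp u \<le> exp z"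
    using r by (simp add: powr_def flip: exp_add)
  moreover have "1 + z \<le> r powr p * (1 + u)"
  proof -
    have "1 + z \<le> r * (1 + u)" using r pos by (simp add: r_def field_simps)
    also have "\<dots> \<le> r powr p * (1 + u)"
      using r pos powr_mono[of 1 p r] assms by (intro mult_right_mono) auto
    finally show ?thesis .
  qed
  ultimately have "r powr p * (exp u - 1 - u) \<le> exp z - 1 - z"
    by (simp add: algebra_simps)
  moreover have "(u / z) powr p = 1 / r powr p"
    using pos by (simp add: r_def powr_divide)
  ultimately show ?thesis using r by (simp add: pos_le_divide_eq mult.commute)
qed

lemma exp_chord_le:
  fixes s u :: real
  assumes "0 \<le> s" "s \<le> 1"
  shows "exp (s * u) \<le> 1 - s + s * exp u"
  using convex_onD[OF exp_convex, of s 0 u] assms by simp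

text \<open>The left side decreases from \<open>2 * exp (- 2)\<close>, about 0.271, against about
  0.307 on the right. With \<open>\<alpha> = exp (- s)\<close> this reads
  \<open>exp (s * \<alpha> - 1) \<le> 1 / 2\<close>, the factor that makes room for half of the tail
  moment below.\<close>

lemma mult_exp_minus_le:
  fixes s :: real
  assumes "2 \<le> s"
  shows "s * exp (- s) \<le> 1 - ln 2"
proof -
  have "s / 2 \<le> exp (s / 2 - 1)" using exp_ge_add_one_self[of "s / 2 - 1"] by simp
  then have "s * exp (- s) \<le> 2 * exp (s / 2 - 1) * exp (- s)" by (intro mult_right_mono) auto
  also have "\<dots> = 2 * exp (- s / 2 - 1)" by (simp flip: exp_add)
  also have "\<dots> \<le> 2 * exp (- 2)" using assms by simp
  finally have 1: "s * exp (- s) \<le> 2 / exp 2" by (simp add: exp_minus field_simps)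
  \<comment> \<open>\<open>13 / 8\<close> is the quadratic Taylor polynomial of exp at
    \<open>1 / 2\<close>.\<close>
  have "(13 / 8) ^ 4 \<le> exp (1 / 2 :: real) ^ 4"
    using exp_lower_Taylor_quadratic[of "1 / 2 :: real"] by (intro power_mono) (auto simp: power2_eq_square)
  also have "\<dots> = exp 2" by (simp flip: exp_of_nat_mult)
  finally have "2 / exp 2 \<le> 2 / (13 / 8 :: real) ^ 4" by (intro divide_left_mono) auto
  then have "2 / exp 2 \<le> (11 / 36 :: real)" by (simp add: power4_eq_xxxx)
  then show ?thesis using 1 ln2_le_25_over_36 by linarith
qed

text \<open>The coefficient of the truncated \<open>p\<close>-th moment when \<open>e\<^sup>h\<^sup>d\<close> is averaged over \<open>d \<le> c\<close>, with \<open>z = h c\<close>;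
  for \<open>z \<le> p\<close> the quadratic term alone suffices.\<close>

definition exp_excess :: "real \<Rightarrow> real \<Rightarrow> real" where
  "exp_excess p z = (if z > p then exp z - 1 - z else 0)"

lemma exp_excess_nonneg: "0 \<le> exp_excess p z"
  using exp_ge_add_one_self[of z] unfolding exp_excess_def by (auto split: if_split simp del: exp_ge_add_one_self)

text \<open>Here \<open>\<alpha>\<close> stands for the sum of the \<open>p\<close>-th moments over \<open>c\<^sup>p\<close> and \<open>\<tau>\<close> for its part above \<open>c\<close>. The unconstrained
  optimum \<open>h1\<close> of the Gaussian part is used as long as \<open>h1 c\<close> stays below \<open>p\<close> or \<open>ln (1 / \<alpha>)\<close>; otherwise
  \<open>h c\<close> is the larger of these two. Since \<open>\<tau>\<close> enters the union bound once and the exponential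
  bound twice (for the two signs), only \<open>\<tau> / 2\<close> has to be absorbed.\<close>

lemma fuk_nagaev_optimization:
  fixes p x V \<alpha> \<tau> :: real
  assumes p: "2 \<le> p" and x: "0 < x" and V: "0 < V"
    and \<tau>: "0 \<le> \<tau>" "\<tau> \<le> \<alpha>" and \<alpha>: "0 < \<alpha>" "\<alpha> < 1"
  defines "c \<equiv> p / (p + 2) * x"
  obtains h where "0 < h"
    "\<tau> / 2 + exp (- (h * x) + exp p * h\<^sup>2 * V / 2 + exp_excess p (h * c) * (\<alpha> - \<tau>) + h * c * \<tau>)
       \<le> \<alpha> + exp (- (2 / ((p + 2)\<^sup>2 * exp p) * (x\<^sup>2 / V)))"
proof -
  note thesisI = that
  \<comment> \<open>\<open>h1\<close> minimizes \<open>- h * (x - c) + exp p * h^2 * V / 2\<close>,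
    and the minimum is \<open>- E\<close>. The remaining \<open>- h1 * c\<close> is a reserve
    against the p-th moment terms.\<close>
  define h1 where "h1 = 2 * x / ((p + 2) * exp p * V)"
  define E where "E = 2 / ((p + 2)\<^sup>2 * exp p) * (x\<^sup>2 / V)"
  define l where "l = - ln \<alpha>"
  define T where "T = (\<lambda>h. - (h * x) + exp p * h\<^sup>2 * V / 2 + exp_excess p (h * c) * (\<alpha> - \<tau>) + h * c * \<tau>)"
  have c: "0 < c" using p x by (simp add: c_def)
  have h1: "0 < h1" using p x V by (simp add: h1_def)
  have exp_l: "exp (- l) = \<alpha>" "exp l * \<alpha> = 1"
    using \<alpha> by (auto simp: l_def exp_minus)
  have quad_h1: "- (h1 * x) + exp p * h1\<^sup>2 * V / 2 = - E - h1 * c"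
  proof -
    define q where "q = exp p"
    have "q > 0" "p + 2 > 0" using p by (auto simp: q_def)
    then show ?thesis using V
      by (simp add: h1_def E_def c_def q_def[symmetric] divide_simps power2_eq_square)
         (simp add: algebra_simps)
  qed
  have quad: "- (h * x) + exp p * h\<^sup>2 * V / 2 \<le> - (h * c) - h * c / p" if "0 < h" "h \<le> h1" for h
  proof -
    have "exp p * V * h \<le> exp p * V * h1" using that V by simp
    also have "\<dots> = 2 * x / (p + 2)" using V p by (simp add: h1_def)
    finally have "h * (exp p * V * h) \<le> h * (2 * x / (p + 2))"
      using that by (intro mult_left_mono) auto
    also have "\<dots> = 2 * (h * x / (p + 2))" by simp
    finally have "h * (exp p * V * h) \<le> 2 * (h * x / (p + 2))" .
    then have "- (h * x) + exp p * h\<^sup>2 * V / 2 \<le> - (h * x) + h * x / (p + 2)"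
      by (simp add: power2_eq_square mult_ac)
    also have "\<dots> = - (h * c) - h * c / p"
      using p by (simp add: c_def divide_simps) (simp add: algebra_simps)
    finally show ?thesis .
  qed
  have goal: thesis if "0 < h" "\<tau> / 2 + exp (T h) \<le> \<alpha> + exp (- E)" for h
    using that by (intro thesisI[of h]) (simp_all add: T_def E_def)
  consider "h1 * c \<le> p" | "p < h1 * c" "h1 * c \<le> l" | "p < h1 * c" "l < h1 * c" "l \<le> p"
    | "l < h1 * c" "p < l" by linarith
  then show thesis
  proof cases
    case 1
    have "h1 * c * \<tau> \<le> h1 * c" using h1 c \<tau> \<alpha> by (simp add: mult_le_cancel_left1)
    then have "T h1 \<le> - E"
      using 1 quad_h1 by (simp add: T_def exp_excess_def)
    then show ?thesis using h1 \<tau> by (intro goal[of h1]) (auto intro: add_mono)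
  next
    case 2
    \<comment> \<open>As \<open>exp z * \<alpha> \<le> 1\<close>, the p-th moment terms add up to at
      most 1, which the reserve \<open>- z\<close> absorbs.\<close>
    define z where "z = h1 * c"
    have "exp z * \<alpha> \<le> exp l * \<alpha>" using 2 \<alpha> by (simp add: z_def)
    then have "exp z * \<alpha> \<le> 1" using exp_l by simp
    moreover have "z * \<tau> \<le> exp z * \<tau>"
    proof (rule mult_right_mono)
      show "z \<le> exp z" using exp_ge_add_one_self[of z] by linarith
    qed fact
    moreover have "(exp z - 1 - z) * (\<alpha> - \<tau>) \<le> exp z * (\<alpha> - \<tau>)"
      using \<tau> 2 p by (intro mult_right_mono) (auto simp: z_def)
    moreover have "2 \<le> z" using 2 p by (simp add: z_def)
    ultimately have "(exp z - 1 - z) * (\<alpha> - \<tau>) + z * \<tau> \<le> z"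
      by (simp add: right_diff_distrib)
    then have "T h1 \<le> - E"
      using 2 quad_h1 by (simp add: T_def exp_excess_def z_def)
    then show ?thesis using h1 \<tau> by (intro goal[of h1]) (auto intro: add_mono)
  next
    case 3
    \<comment> \<open>At \<open>h * c = p\<close> the excess still vanishes. Convexity of exp
      between \<open>- p\<close> and 0 bounds \<open>\<alpha> = exp (- l)\<close>, hence
      \<open>p * \<tau>\<close>, well enough for \<open>exp (T h) \<le> \<alpha> / 2\<close>; the
      other half of \<open>\<alpha>\<close> pays for \<open>\<tau> / 2\<close>.\<close>
    define h where "h = p / c"
    have h: "h * c = p" "0 < h" "h \<le> h1" using 3 c p by (auto simp: h_def field_simps)
    have "0 \<le> l" using \<alpha> by (simp add: l_def)
    have "exp ((l / p) * (- p)) \<le> 1 - l / p + l / p * exp (- p)"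
      using 3 p \<open>0 \<le> l\<close> by (intro exp_chord_le) auto
    then have "\<alpha> \<le> 1 - l / p + l / p * exp (- p)" using p exp_l by simp
    then have "p * \<alpha> \<le> p * (1 - l / p + l / p * exp (- p))" using p by simp
    also have "\<dots> = p - l + l * exp (- p)" using p by (simp add: field_simps)
    also have "\<dots> \<le> p - l + p * exp (- p)" using 3 by simp
    also have "\<dots> \<le> p - l + (1 - ln 2)" using mult_exp_minus_le p by simp
    finally have "p * \<tau> \<le> p - l + 1 - ln 2"
      using \<tau> p by (smt (verit) mult_left_mono)
    moreover have "T h \<le> - p - 1 + p * \<tau>"
      using quad[of h] h p by (simp add: T_def exp_excess_def)
    ultimately have "exp (T h) \<le> exp (- l - ln 2)" by simp
    also have "\<dots> = \<alpha> / 2" using exp_l by (simp add: exp_diff)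
    finally show ?thesis using h \<tau> by (intro goal[of h]) (auto intro: add_increasing2)
  next
    case 4
    \<comment> \<open>Now \<open>exp (h * c) * \<alpha> = 1\<close>. The share \<open>s\<close> of
      the moment lying above \<open>c\<close> is charged only linearly, and this saving lowers the
      bound \<open>\<alpha>\<close> by the required \<open>\<tau> / 2\<close>.\<close>
    define h where "h = l / c"
    have l: "2 < l" using 4 p by simp
    have h: "h * c = l" "0 < h" "h \<le> h1" using 4 c p by (auto simp: h_def field_simps)
    define s where "s = \<tau> / \<alpha>"
    have s: "0 \<le> s" "s \<le> 1" "\<tau> = s * \<alpha>" using \<tau> \<alpha> by (auto simp: s_def)
    have "(exp l - 1 - l) * (\<alpha> - \<tau>) \<le> exp l * (\<alpha> - \<tau>)"
      using \<tau> l by (intro mult_right_mono) auto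
    also have "\<dots> = exp l * \<alpha> * (1 - s)" by (simp add: s algebra_simps)
    finally have "exp_excess p l * (\<alpha> - \<tau>) \<le> 1 - s"
      using 4 exp_l by (simp add: exp_excess_def)
    moreover have "1 \<le> l / p" using 4 p by simp
    ultimately have "T h \<le> - l - s * (1 - l * \<alpha>)"
      using quad[OF h(2,3)] unfolding T_def h(1) by (simp add: s right_diff_distrib mult_ac)
    then have "exp (T h) \<le> exp (- l) * exp (s * (l * \<alpha> - 1))"
      by (simp add: algebra_simps flip: exp_add)
    also have "\<dots> \<le> \<alpha> * (1 - s + s * exp (l * \<alpha> - 1))"
      unfolding exp_l using \<alpha> s by (intro mult_left_mono exp_chord_le) auto
    also have "\<dots> \<le> \<alpha> * (1 - s + s * (1 / 2))"
    proof -
      have "l * \<alpha> \<le> 1 - ln 2" using mult_exp_minus_le[of l] l exp_l by simp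
      then have "exp (l * \<alpha> - 1) \<le> exp (- ln 2)" by simp
      then show ?thesis using \<alpha> s
        by (intro mult_left_mono add_left_mono) (auto simp: exp_minus)
    qed
    also have "\<dots> = \<alpha> - \<tau> / 2" by (simp add: s algebra_simps)
    finally show ?thesis using h by (intro goal[of h]) (auto intro: add_increasing2)
  qed
qed

section \<open>A Fuk--Nagaev inequality for martingales driven by independent innovations\<close>

text \<open>When \<open>e > c\<close> the left-hand side vanishes, and the term in \<open>h c\<close> compensates for a negative
  \<open>h d\<close>. So the truncation does not have to preserve the mean of \<open>d\<close>.\<close>

lemma truncated_exp_le:
  fixes c d e h p :: real
  assumes "2 \<le> p" "0 < c" "0 < h" "\<bar>d\<bar> \<le> e"
  shows "exp (h * d) * indicator {..c} e
    \<le> 1 + h * d + h * c * ((e / c) powr p * indicator {c<..} e) + exp p * h\<^sup>2 / 2 * e\<^sup>2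
      + exp_excess p (h * c) * ((e / c) powr p * indicator {..c} e)"
proof (cases "e \<le> c")
  case False
  have "(e / c) powr 1 \<le> (e / c) powr p" using False assms by (intro powr_mono) auto
  then have "h * c * (e / c) \<le> h * c * (e / c) powr p"
    using assms False by (intro mult_left_mono) auto
  then have "h * e \<le> h * c * (e / c) powr p" using assms by simp
  moreover have "h * - e \<le> h * d" using assms by (intro mult_left_mono) auto
  moreover have "0 \<le> exp p * h\<^sup>2 / 2 * e\<^sup>2" by simp
  ultimately show ?thesis using False by simp
next
  case True
  have sq: "exp p * (h * d)\<^sup>2 / 2 \<le> exp p * h\<^sup>2 / 2 * e\<^sup>2"
    using power_mono[of "\<bar>d\<bar>" e 2] assms by (simp add: power_mult_distrib)
  show ?thesis
  proof (cases "h * d \<le> p")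
    case small: True
    have "exp (h * d) - 1 - h * d \<le> exp p * (h * d)\<^sup>2 / 2"
      using small assms by (intro exp_remainder_le_square) auto
    note order_trans[OF this sq]
    moreover have "0 \<le> exp_excess p (h * c) * (e / c) powr p"
      by (simp add: exp_excess_nonneg)
    ultimately show ?thesis using True by simp
  next
    case large: False
    have "d \<le> c" using assms True by linarith
    then have le: "h * d \<le> h * c" using assms by simp
    have "0 < h * d" using large assms by simp
    then have "0 < d" using assms zero_less_mult_pos by blast
    have "exp (h * d) - 1 - h * d \<le> (exp (h * c) - 1 - h * c) * (h * d / (h * c)) powr p"
      using large le assms by (intro exp_remainder_scaling) auto
    also have "\<dots> = exp_excess p (h * c) * (d / c) powr p"
    proof -
      have "p < h * c" using large le by linarith
      then show ?thesis using assms by (simp add: exp_excess_def)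
    qed
    also have "\<dots> \<le> exp_excess p (h * c) * (e / c) powr p"
      using assms \<open>0 < d\<close>
      by (intro mult_left_mono powr_mono2 divide_right_mono exp_excess_nonneg) auto
    finally have "exp (h * d) - 1 - h * d \<le> exp_excess p (h * c) * (e / c) powr p" .
    moreover have "0 \<le> exp p * h\<^sup>2 / 2 * e\<^sup>2" by simp
    ultimately have "exp (h * d) \<le> 1 + h * d + exp p * h\<^sup>2 / 2 * e\<^sup>2
        + exp_excess p (h * c) * (e / c) powr p" by linarith
    then show ?thesis using True by simp
  qed
qed

text \<open>The tail moment \<open>\<tau>\<close> stays exact because the same number bounds the
  probability that \<open>\<eta>\<close> exceeds \<open>c\<close>; the moment below \<open>c\<close>
  is estimated by what \<open>\<tau>\<close> leaves of \<open>A / c powr p\<close>. Integrating the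
  pointwise bound removes the linear term, and \<open>1 + t \<le> exp t\<close> gives a form that
  multiplies well.\<close>

lemma (in prob_space) truncated_mgf_le:
  fixes c h p v A :: real and d \<eta> :: "'a \<Rightarrow> real"
  assumes "2 \<le> p" "0 < c" "0 < h"
    and meas [measurable]: "d \<in> borel_measurable M" "\<eta> \<in> borel_measurable M"
    and le: "\<And>y. y \<in> space M \<Longrightarrow> \<bar>d y\<bar> \<le> \<eta> y"
    and centered: "expectation d = 0"
    and sq: "integrable M (\<lambda>y. (\<eta> y)\<^sup>2)" "expectation (\<lambda>y. (\<eta> y)\<^sup>2) \<le> v"
    and pow: "integrable M (\<lambda>y. \<eta> y powr p)" "expectation (\<lambda>y. \<eta> y powr p) \<le> A"
  defines "\<tau> \<equiv> expectation (\<lambda>y. (\<eta> y / c) powr p * indicator {c<..} (\<eta> y))"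
  shows "(\<integral>\<^sup>+y. ennreal (exp (h * d y) * indicator {..c} (\<eta> y)) \<partial>M)
    \<le> ennreal (exp (exp p * h\<^sup>2 / 2 * v + exp_excess p (h * c) * (A / c powr p - \<tau>) + h * c * \<tau>))"
proof -
  have pow': "integrable M (\<lambda>y. (\<eta> y / c) powr p)"
    using pow by (simp add: powr_divide)
  have ind: "integrable M (\<lambda>y. (\<eta> y / c) powr p * indicator B (\<eta> y))" if [measurable]: "B \<in> sets borel" for B
    by (rule Bochner_Integration.integrable_bound[OF pow']) (auto simp: indicator_def)
  have "integrable M (\<lambda>y. (\<eta> y)\<^sup>2 + 1)" using sq by simp
  then have d: "integrable M d"
  proof (rule Bochner_Integration.integrable_bound)
    show "AE y in M. norm (d y) \<le> norm ((\<eta> y)\<^sup>2 + 1)"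
    proof (rule AE_I2)
      fix y assume "y \<in> space M"
      have "\<eta> y \<le> (\<eta> y)\<^sup>2 + 1" using sum_power2_ge_zero[of "\<eta> y - 1/2" 0]
        by (simp add: power2_eq_square algebra_simps)
      then show "norm (d y) \<le> norm ((\<eta> y)\<^sup>2 + 1)" using le[OF \<open>y \<in> space M\<close>] by simp
    qed
  qed auto
  define \<sigma> where "\<sigma> = expectation (\<lambda>y. (\<eta> y / c) powr p * indicator {..c} (\<eta> y))"
  define R where "R = (\<lambda>y. 1 + h * d y + h * c * ((\<eta> y / c) powr p * indicator {c<..} (\<eta> y))
      + exp p * h\<^sup>2 / 2 * (\<eta> y)\<^sup>2
      + exp_excess p (h * c) * ((\<eta> y / c) powr p * indicator {..c} (\<eta> y)))"
  have intR: "integrable M R" unfolding R_def using d sq ind by auto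
  have pointwise: "exp (h * d y) * indicator {..c} (\<eta> y) \<le> R y" if "y \<in> space M" for y
    unfolding R_def using truncated_exp_le[OF assms(1-3) le[OF that]] .
  have "\<sigma> + \<tau> = expectation (\<lambda>y. (\<eta> y / c) powr p * indicator {..c} (\<eta> y)
      + (\<eta> y / c) powr p * indicator {c<..} (\<eta> y))"
    unfolding \<sigma>_def \<tau>_def
    by (intro Bochner_Integration.integral_add[symmetric] ind) simp_all
  also have "\<dots> = expectation (\<lambda>y. (\<eta> y / c) powr p)"
    by (intro Bochner_Integration.integral_cong) (auto simp: indicator_def)
  also have "\<dots> = expectation (\<lambda>y. \<eta> y powr p / c powr p)"
    by (simp add: powr_divide)
  also have "\<dots> \<le> A / c powr p" using pow by (simp add: divide_right_mono)
  finally have \<sigma>: "\<sigma> \<le> A / c powr p - \<tau>" by simp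
  have "(\<integral>\<^sup>+y. ennreal (exp (h * d y) * indicator {..c} (\<eta> y)) \<partial>M) \<le> (\<integral>\<^sup>+y. ennreal (R y) \<partial>M)"
    using pointwise by (intro nn_integral_mono ennreal_leI)
  also have "\<dots> = ennreal (expectation R)"
  proof (rule nn_integral_eq_integral[OF intR], rule AE_I2)
    fix y assume "y \<in> space M"
    from pointwise[OF this] show "0 \<le> R y"
      by (rule order_trans[rotated]) simp
  qed
  also have "expectation R = 1 + h * c * \<tau> + exp p * h\<^sup>2 / 2 * expectation (\<lambda>y. (\<eta> y)\<^sup>2) + exp_excess p (h * c) * \<sigma>"
    unfolding R_def \<sigma>_def \<tau>_def using d sq ind centered by (simp add: prob_space)
  also have "\<dots> \<le> 1 + h * c * \<tau> + exp p * h\<^sup>2 / 2 * v + exp_excess p (h * c) * (A / c powr p - \<tau>)"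
    using sq(2) \<sigma> by (intro add_mono mult_left_mono exp_excess_nonneg order_refl) auto
  also have "\<dots> \<le> exp (exp p * h\<^sup>2 / 2 * v + exp_excess p (h * c) * (A / c powr p - \<tau>) + h * c * \<tau>)"
    using exp_ge_add_one_self[of "exp p * h\<^sup>2 / 2 * v + exp_excess p (h * c) * (A / c powr p - \<tau>) + h * c * \<tau>"]
    by linarith
  finally show ?thesis by (simp add: ennreal_leI)
qed

section \<open>Integrating out the present innovation with the past frozen\<close>

lemma (in prob_space) nn_integral_indep_var:
  assumes "indep_var S X T Y" and [measurable]: "g \<in> borel_measurable (S \<Otimes>\<^sub>M T)"
  shows "(\<integral>\<^sup>+\<omega>. g (X \<omega>, Y \<omega>) \<partial>M) = (\<integral>\<^sup>+\<omega>. \<integral>\<^sup>+y. g (X \<omega>, y) \<partial>distr M T Y \<partial>M)"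
proof -
  have [measurable]: "X \<in> M \<rightarrow>\<^sub>M S" "Y \<in> M \<rightarrow>\<^sub>M T"
    using indep_var_rv1[OF assms(1)] indep_var_rv2[OF assms(1)] .
  interpret Y: prob_space "distr M T Y" by (rule prob_space_distr) simp
  have "(\<integral>\<^sup>+\<omega>. g (X \<omega>, Y \<omega>) \<partial>M) = (\<integral>\<^sup>+z. g z \<partial>distr M (S \<Otimes>\<^sub>M T) (\<lambda>\<omega>. (X \<omega>, Y \<omega>)))"
    by (simp add: nn_integral_distr)
  also have "\<dots> = (\<integral>\<^sup>+z. g z \<partial>(distr M S X \<Otimes>\<^sub>M distr M T Y))"
    using assms(1) by (simp add: indep_var_distribution_eq)
  also have "\<dots> = (\<integral>\<^sup>+x. \<integral>\<^sup>+y. g (x, y) \<partial>distr M T Y \<partial>distr M S X)"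
    by (subst Y.nn_integral_fst[symmetric]) (auto simp: measurable_distr_eq1 cong: measurable_cong_sets)
  also have "\<dots> = (\<integral>\<^sup>+\<omega>. \<integral>\<^sup>+y. g (X \<omega>, y) \<partial>distr M T Y \<partial>M)"
    by (subst nn_integral_distr) auto
  finally show ?thesis .
qed

lemma (in prob_space) nn_integral_past_present:
  fixes \<epsilon> :: "nat \<Rightarrow> 'a \<Rightarrow> 'y"
  assumes indep: "indep_vars N \<epsilon> {1..n}" and k: "k \<in> {1..n}"
    and g [measurable]: "g \<in> borel_measurable ((\<Pi>\<^sub>M j\<in>{1..<k}. N j) \<Otimes>\<^sub>M N k)"
  shows "(\<integral>\<^sup>+\<omega>. g (\<lambda>j\<in>{1..<k}. \<epsilon> j \<omega>, \<epsilon> k \<omega>) \<partial>M)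
    = (\<integral>\<^sup>+\<omega>. \<integral>\<^sup>+y. g (\<lambda>j\<in>{1..<k}. \<epsilon> j \<omega>, y) \<partial>distr M (N k) (\<epsilon> k) \<partial>M)"
proof -
  have rv: "\<epsilon> j \<in> M \<rightarrow>\<^sub>M N j" if "j \<in> {1..n}" for j
    using indep that by (simp add: indep_vars_def)
  note [measurable] = rv[OF k]
  have past [measurable]: "(\<lambda>\<omega>. \<lambda>j\<in>{1..<k}. \<epsilon> j \<omega>) \<in> M \<rightarrow>\<^sub>M (\<Pi>\<^sub>M j\<in>{1..<k}. N j)"
    using k by (intro measurable_restrict rv) auto
  \<comment> \<open>The present enters as a one-point tuple, so that past and present are disjoint
    blocks of coordinates; the tuple is then evaluated at \<open>k\<close>.\<close>
  have "indep_var (\<Pi>\<^sub>M j\<in>{1..<k}. N j) (\<lambda>\<omega>. \<lambda>j\<in>{1..<k}. \<epsilon> j \<omega>)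
      (\<Pi>\<^sub>M j\<in>{k}. N j) (\<lambda>\<omega>. \<lambda>j\<in>{k}. \<epsilon> j \<omega>)"
    using indep k by (intro indep_var_restrict[of N \<epsilon> "{1..n}"]) auto
  moreover have "(\<lambda>(e, z). g (e, z k)) \<in> borel_measurable ((\<Pi>\<^sub>M j\<in>{1..<k}. N j) \<Otimes>\<^sub>M (\<Pi>\<^sub>M j\<in>{k}. N j))"
    by measurable
  ultimately have "(\<integral>\<^sup>+\<omega>. (\<lambda>(e, z). g (e, z k)) (\<lambda>j\<in>{1..<k}. \<epsilon> j \<omega>, \<lambda>j\<in>{k}. \<epsilon> j \<omega>) \<partial>M)
      = (\<integral>\<^sup>+\<omega>. \<integral>\<^sup>+z. (\<lambda>(e, z). g (e, z k)) (\<lambda>j\<in>{1..<k}. \<epsilon> j \<omega>, z)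
          \<partial>distr M (\<Pi>\<^sub>M j\<in>{k}. N j) (\<lambda>\<omega>. \<lambda>j\<in>{k}. \<epsilon> j \<omega>) \<partial>M)"
    by (rule nn_integral_indep_var)
  then have "(\<integral>\<^sup>+\<omega>. g (\<lambda>j\<in>{1..<k}. \<epsilon> j \<omega>, \<epsilon> k \<omega>) \<partial>M)
      = (\<integral>\<^sup>+\<omega>. \<integral>\<^sup>+z. g (\<lambda>j\<in>{1..<k}. \<epsilon> j \<omega>, z k)
          \<partial>distr M (\<Pi>\<^sub>M j\<in>{k}. N j) (\<lambda>\<omega>. \<lambda>j\<in>{k}. \<epsilon> j \<omega>) \<partial>M)"
    by simp
  also have "\<dots> = (\<integral>\<^sup>+\<omega>. \<integral>\<^sup>+y. g (\<lambda>j\<in>{1..<k}. \<epsilon> j \<omega>, y) \<partial>distr M (N k) (\<epsilon> k) \<partial>M)"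
  proof (intro nn_integral_cong)
    fix \<omega> assume \<omega>: "\<omega> \<in> space M"
    define e where "e = (\<lambda>j\<in>{1..<k}. \<epsilon> j \<omega>)"
    have "e \<in> space (\<Pi>\<^sub>M j\<in>{1..<k}. N j)"
      using measurable_space[OF past \<omega>] by (simp add: e_def)
    note [measurable] = measurable_Pair2[OF g this]
    have "(\<lambda>\<omega>. \<lambda>j\<in>{k}. \<epsilon> j \<omega>) \<in> M \<rightarrow>\<^sub>M (\<Pi>\<^sub>M j\<in>{k}. N j)"
      using k by (intro measurable_restrict rv) auto
    then have "(\<integral>\<^sup>+z. g (e, z k) \<partial>distr M (\<Pi>\<^sub>M j\<in>{k}. N j) (\<lambda>\<omega>. \<lambda>j\<in>{k}. \<epsilon> j \<omega>))
        = (\<integral>\<^sup>+\<omega>'. g (e, \<epsilon> k \<omega>') \<partial>M)"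
      by (subst nn_integral_distr) auto
    also have "\<dots> = (\<integral>\<^sup>+y. g (e, y) \<partial>distr M (N k) (\<epsilon> k))"
      by (subst nn_integral_distr) auto
    finally show "(\<integral>\<^sup>+z. g (\<lambda>j\<in>{1..<k}. \<epsilon> j \<omega>, z k) \<partial>distr M (\<Pi>\<^sub>M j\<in>{k}. N j) (\<lambda>\<omega>. \<lambda>j\<in>{k}. \<epsilon> j \<omega>))
        = (\<integral>\<^sup>+y. g (\<lambda>j\<in>{1..<k}. \<epsilon> j \<omega>, y) \<partial>distr M (N k) (\<epsilon> k))"
      unfolding e_def .
  qed
  finally show ?thesis .
qed

text \<open>The bounds \<open>m k\<close> are uniform in the past, so the last innovation can be
  integrated out first and its factor pulled out, although the weights themselves depend on the
  past.\<close>

lemma (in prob_space) nn_integral_prod_past_le: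
  fixes \<epsilon> :: "nat \<Rightarrow> 'a \<Rightarrow> 'y" and w :: "nat \<Rightarrow> (nat \<Rightarrow> 'y) \<Rightarrow> 'y \<Rightarrow> ennreal"
  assumes indep: "indep_vars N \<epsilon> {1..n}"
    and w: "\<And>k. k \<in> {1..n} \<Longrightarrow> (\<lambda>(e, y). w k e y) \<in> borel_measurable ((\<Pi>\<^sub>M j\<in>{1..<k}. N j) \<Otimes>\<^sub>M N k)"
    and le: "\<And>k e. k \<in> {1..n} \<Longrightarrow> e \<in> space (\<Pi>\<^sub>M j\<in>{1..<k}. N j) \<Longrightarrow>
      (\<integral>\<^sup>+y. w k e y \<partial>distr M (N k) (\<epsilon> k)) \<le> m k"
  shows "(\<integral>\<^sup>+\<omega>. (\<Prod>k=1..n. w k (\<lambda>j\<in>{1..<k}. \<epsilon> j \<omega>) (\<epsilon> k \<omega>)) \<partial>M) \<le> (\<Prod>k=1..n. m k)"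
proof -
  have "(\<integral>\<^sup>+\<omega>. (\<Prod>k=1..i. w k (\<lambda>j\<in>{1..<k}. \<epsilon> j \<omega>) (\<epsilon> k \<omega>)) \<partial>M) \<le> (\<Prod>k=1..i. m k)" if "i \<le> n" for i
    using that
  proof (induction i)
    case 0
    then show ?case by (simp add: emeasure_space_1)
  next
    case (Suc i)
    \<comment> \<open>The earlier factors must be a function of the single tuple that is frozen, so
      each restricts that tuple to its own past.\<close>
    define W where "W = (\<lambda>e. \<Prod>k=1..i. w k (restrict e {1..<k}) (e k))"
    define T where "T = (\<lambda>\<omega>. \<lambda>j\<in>{1..<Suc i}. \<epsilon> j \<omega>)"
    have W_T: "W (T \<omega>) = (\<Prod>k=1..i. w k (\<lambda>j\<in>{1..<k}. \<epsilon> j \<omega>) (\<epsilon> k \<omega>))" for \<omega>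
      unfolding W_def T_def
      by (intro prod.cong refl) (auto intro!: arg_cong2[where f = "w _"] simp: fun_eq_iff restrict_def)
    have W [measurable]: "W \<in> borel_measurable (\<Pi>\<^sub>M j\<in>{1..<Suc i}. N j)"
      unfolding W_def
    proof (intro borel_measurable_prod_ennreal)
      fix k assume k: "k \<in> {1..i}"
      have "(\<lambda>e. (restrict e {1..<k}, e k))
          \<in> (\<Pi>\<^sub>M j\<in>{1..<Suc i}. N j) \<rightarrow>\<^sub>M (\<Pi>\<^sub>M j\<in>{1..<k}. N j) \<Otimes>\<^sub>M N k"
        using k by (intro measurable_Pair measurable_restrict_subset measurable_component_singleton) auto
      from measurable_compose[OF this w[of k]] k Suc.prems
      show "(\<lambda>e. w k (restrict e {1..<k}) (e k)) \<in> borel_measurable (\<Pi>\<^sub>M j\<in>{1..<Suc i}. N j)"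
        by simp
    qed
    have k: "Suc i \<in> {1..n}" using Suc.prems by simp
    note [measurable] = w[OF k]
    have T_meas [measurable]: "T \<in> M \<rightarrow>\<^sub>M (\<Pi>\<^sub>M j\<in>{1..<Suc i}. N j)"
      unfolding T_def using Suc.prems indep by (intro measurable_restrict) (auto simp: indep_vars_def)
    have "(\<integral>\<^sup>+\<omega>. (\<Prod>k=1..Suc i. w k (\<lambda>j\<in>{1..<k}. \<epsilon> j \<omega>) (\<epsilon> k \<omega>)) \<partial>M)
        = (\<integral>\<^sup>+\<omega>. (\<lambda>(e, y). W e * w (Suc i) e y) (T \<omega>, \<epsilon> (Suc i) \<omega>) \<partial>M)"
      by (simp add: W_T) (simp add: T_def)
    also have "\<dots> = (\<integral>\<^sup>+\<omega>. \<integral>\<^sup>+y. W (T \<omega>) * w (Suc i) (T \<omega>) y \<partial>distr M (N (Suc i)) (\<epsilon> (Suc i)) \<partial>M)"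
    proof -
      have "(\<lambda>(e, y). W e * w (Suc i) e y) \<in> borel_measurable ((\<Pi>\<^sub>M j\<in>{1..<Suc i}. N j) \<Otimes>\<^sub>M N (Suc i))"
        by measurable
      from nn_integral_past_present[OF indep k this] show ?thesis by (simp add: T_def)
    qed
    also have "\<dots> \<le> (\<integral>\<^sup>+\<omega>. W (T \<omega>) * m (Suc i) \<partial>M)"
    proof (intro nn_integral_mono)
      fix \<omega> assume "\<omega> \<in> space M"
      from measurable_space[OF T_meas this] have T: "T \<omega> \<in> space (\<Pi>\<^sub>M j\<in>{1..<Suc i}. N j)" .
      have "(\<integral>\<^sup>+y. W (T \<omega>) * w (Suc i) (T \<omega>) y \<partial>distr M (N (Suc i)) (\<epsilon> (Suc i)))
          = W (T \<omega>) * (\<integral>\<^sup>+y. w (Suc i) (T \<omega>) y \<partial>distr M (N (Suc i)) (\<epsilon> (Suc i)))"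
        using measurable_Pair2[OF w[OF k] T] by (intro nn_integral_cmult) simp
      also have "\<dots> \<le> W (T \<omega>) * m (Suc i)"
        using le[OF k T] by (intro mult_left_mono) auto
      finally show "(\<integral>\<^sup>+y. W (T \<omega>) * w (Suc i) (T \<omega>) y \<partial>distr M (N (Suc i)) (\<epsilon> (Suc i)))
          \<le> W (T \<omega>) * m (Suc i)" .
    qed
    also have "\<dots> = (\<integral>\<^sup>+\<omega>. W (T \<omega>) \<partial>M) * m (Suc i)"
      by (intro nn_integral_multc) auto
    also have "\<dots> \<le> (\<Prod>k=1..i. m k) * m (Suc i)"
      unfolding W_T using Suc.prems by (intro mult_right_mono Suc.IH) auto
    also have "\<dots> = (\<Prod>k=1..Suc i. m k)" by simp
    finally show ?case .
  qed
  then show ?thesis by simp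
qed

text \<open>Since \<open>\<eta> k\<close> depends on the present innovation alone, the conditional
  moments of the increments are bounded by constants; the exponent therefore stays deterministic
  even though the increments depend on the past.\<close>

theorem (in prob_space) fuk_nagaev:
  fixes \<epsilon> :: "nat \<Rightarrow> 'a \<Rightarrow> 'y" and D :: "nat \<Rightarrow> (nat \<Rightarrow> 'y) \<Rightarrow> 'y \<Rightarrow> real"
    and \<eta> :: "nat \<Rightarrow> 'y \<Rightarrow> real" and v A :: "nat \<Rightarrow> real" and p x :: real
  assumes indep: "indep_vars N \<epsilon> {1..n}"
    and n: "1 \<le> n" and p: "2 \<le> p" and x: "0 < x"
    and D: "\<And>k. k \<in> {1..n} \<Longrightarrow>
      (\<lambda>(e, y). D k e y) \<in> borel_measurable ((\<Pi>\<^sub>M j\<in>{1..<k}. N j) \<Otimes>\<^sub>M N k)"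
    and \<eta>: "\<And>k. k \<in> {1..n} \<Longrightarrow> \<eta> k \<in> borel_measurable (N k)"
    and D_le: "\<And>k e y. k \<in> {1..n} \<Longrightarrow> e \<in> space (\<Pi>\<^sub>M j\<in>{1..<k}. N j) \<Longrightarrow> y \<in> space (N k) \<Longrightarrow>
      \<bar>D k e y\<bar> \<le> \<eta> k y"
    and centered: "\<And>k e. k \<in> {1..n} \<Longrightarrow> e \<in> space (\<Pi>\<^sub>M j\<in>{1..<k}. N j) \<Longrightarrow>
      (\<integral>y. D k e y \<partial>distr M (N k) (\<epsilon> k)) = 0"
    and v: "\<And>k. k \<in> {1..n} \<Longrightarrow> 0 < v k"
      "\<And>k. k \<in> {1..n} \<Longrightarrow> (\<integral>\<^sup>+\<omega>. ennreal ((\<eta> k (\<epsilon> k \<omega>))\<^sup>2) \<partial>M) \<le> ennreal (v k)"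
    and A: "\<And>k. k \<in> {1..n} \<Longrightarrow> 0 < A k"
      "\<And>k. k \<in> {1..n} \<Longrightarrow> (\<integral>\<^sup>+\<omega>. ennreal (\<eta> k (\<epsilon> k \<omega>) powr p) \<partial>M) \<le> ennreal (A k)"
  defines "S \<equiv> \<lambda>\<omega>. \<Sum>k=1..n. D k (\<lambda>j\<in>{1..<k}. \<epsilon> j \<omega>) (\<epsilon> k \<omega>)"
  shows "prob {\<omega> \<in> space M. x \<le> \<bar>S \<omega>\<bar>}
    \<le> 2 * (1 + 2 / p) powr p * ((\<Sum>k=1..n. A k) / x powr p)
      + 2 * exp (- (2 / ((p + 2)\<^sup>2 * exp p) * (x\<^sup>2 / (\<Sum>k=1..n. v k))))"
proof -
  define P where "P = (\<lambda>k. distr M (N k) (\<epsilon> k))"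
  define c where "c = p / (p + 2) * x"
  define V where "V = (\<Sum>k=1..n. v k)"
  define \<alpha> where "\<alpha> = (\<Sum>k=1..n. A k) / c powr p"
  define \<tau> where "\<tau> = (\<lambda>k. \<integral>y. (\<eta> k y / c) powr p * indicator {c<..} (\<eta> k y) \<partial>P k)"
  have c: "0 < c" using p x by (simp add: c_def)
  have V: "0 < V" unfolding V_def using n v by (intro sum_pos) auto
  have \<alpha>: "0 < \<alpha>" unfolding \<alpha>_def using n A c by (intro divide_pos_pos sum_pos) auto
  have \<epsilon>: "\<epsilon> k \<in> M \<rightarrow>\<^sub>M N k" if "k \<in> {1..n}" for k
    using indep that by (simp add: indep_vars_def)
  have P: "prob_space (P k)" if "k \<in> {1..n}" for k
    unfolding P_def using \<epsilon>[OF that] by (rule prob_space_distr)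
  have \<eta>P: "\<eta> k \<in> borel_measurable (P k)" if "k \<in> {1..n}" for k
    using \<eta>[OF that] by (simp add: P_def)
  have past: "(\<lambda>\<omega>. \<lambda>j\<in>{1..<k}. \<epsilon> j \<omega>) \<in> M \<rightarrow>\<^sub>M (\<Pi>\<^sub>M j\<in>{1..<k}. N j)" if "k \<in> {1..n}" for k
    using that by (intro measurable_restrict \<epsilon>) auto
  have D_meas: "(\<lambda>\<omega>. D k (\<lambda>j\<in>{1..<k}. \<epsilon> j \<omega>) (\<epsilon> k \<omega>)) \<in> borel_measurable M" if "k \<in> {1..n}" for k
    using measurable_compose[OF measurable_Pair[OF past \<epsilon>] D] that by simp
  have S_meas [measurable]: "S \<in> borel_measurable M"
    unfolding S_def by (intro borel_measurable_sum D_meas)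

  have sq: "integrable (P k) (\<lambda>y. (\<eta> k y)\<^sup>2)" "(\<integral>y. (\<eta> k y)\<^sup>2 \<partial>P k) \<le> v k" if k: "k \<in> {1..n}" for k
  proof -
    note [measurable] = \<eta>[OF k] \<epsilon>[OF k]
    have le: "(\<integral>\<^sup>+y. ennreal ((\<eta> k y)\<^sup>2) \<partial>P k) \<le> ennreal (v k)"
      using v(2)[OF k] by (simp add: P_def nn_integral_distr)
    then show int: "integrable (P k) (\<lambda>y. (\<eta> k y)\<^sup>2)"
      using \<eta>P[OF k] by (intro integrableI_nonneg) (auto simp: le_less_trans)
    show "(\<integral>y. (\<eta> k y)\<^sup>2 \<partial>P k) \<le> v k"
      using le v(1)[OF k] nn_integral_eq_integral[OF int] by (simp add: ennreal_le_iff)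
  qed
  have pow: "integrable (P k) (\<lambda>y. \<eta> k y powr p)" "(\<integral>y. \<eta> k y powr p \<partial>P k) \<le> A k" if k: "k \<in> {1..n}" for k
  proof -
    note [measurable] = \<eta>[OF k] \<epsilon>[OF k]
    have le: "(\<integral>\<^sup>+y. ennreal (\<eta> k y powr p) \<partial>P k) \<le> ennreal (A k)"
      using A(2)[OF k] by (simp add: P_def nn_integral_distr)
    then show int: "integrable (P k) (\<lambda>y. \<eta> k y powr p)"
      using \<eta>P[OF k] by (intro integrableI_nonneg) (auto simp: le_less_trans)
    show "(\<integral>y. \<eta> k y powr p \<partial>P k) \<le> A k"
      using le A(1)[OF k] nn_integral_eq_integral[OF int] by (simp add: ennreal_le_iff)
  qed
  have \<tau>_int: "integrable (P k) (\<lambda>y. (\<eta> k y / c) powr p * indicator {c<..} (\<eta> k y))" if k: "k \<in> {1..n}" for k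
  proof (rule Bochner_Integration.integrable_bound)
    note [measurable] = \<eta>P[OF k]
    show "integrable (P k) (\<lambda>y. \<eta> k y powr p / c powr p)" using pow(1)[OF k] by simp
    show "(\<lambda>y. (\<eta> k y / c) powr p * indicator {c<..} (\<eta> k y)) \<in> borel_measurable (P k)" by measurable
    show "AE y in P k. norm ((\<eta> k y / c) powr p * indicator {c<..} (\<eta> k y)) \<le> norm (\<eta> k y powr p / c powr p)"
      by (auto simp: indicator_def powr_divide)
  qed
  have \<tau>_nonneg: "0 \<le> \<tau> k" for k unfolding \<tau>_def by simp
  have \<tau>_le: "\<tau> k \<le> A k / c powr p" if k: "k \<in> {1..n}" for k
  proof -
    have "\<tau> k \<le> (\<integral>y. \<eta> k y powr p / c powr p \<partial>P k)"
      unfolding \<tau>_def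
      by (intro integral_mono \<tau>_int[OF k]) (use pow(1)[OF k] in \<open>auto simp: indicator_def powr_divide\<close>)
    then show ?thesis using pow(2)[OF k] by (simp add: divide_right_mono order_trans)
  qed
  \<comment> \<open>Markov's inequality restricted to the region above \<open>c\<close>, so that
    only \<open>\<tau> k\<close> is spent and not the full moment.\<close>
  have tail: "prob {\<omega> \<in> space M. c < \<eta> k (\<epsilon> k \<omega>)} \<le> \<tau> k" if k: "k \<in> {1..n}" for k
  proof -
    note [measurable] = \<eta>[OF k] \<epsilon>[OF k]
    interpret P: prob_space "P k" by (rule P[OF k])
    have [simp]: "space (P k) = space (N k)" "sets (P k) = sets (N k)" by (auto simp: P_def)
    have "prob {\<omega> \<in> space M. c < \<eta> k (\<epsilon> k \<omega>)} = P.prob {y \<in> space (N k). c < \<eta> k y}"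
      unfolding P_def
      by (subst measure_distr) (auto intro!: arg_cong[where f = prob] dest: measurable_space[OF \<epsilon>[OF k]])
    also have "\<dots> = (\<integral>y. indicator {y \<in> space (N k). c < \<eta> k y} y \<partial>P k)"
      by simp
    also have "\<dots> \<le> \<tau> k"
      unfolding \<tau>_def
    proof (intro integral_mono \<tau>_int[OF k])
      show "integrable (P k) (indicator {y \<in> space (N k). c < \<eta> k y} :: _ \<Rightarrow> real)"
        by (intro integrable_real_indicator) (auto simp: P.emeasure_eq_measure)
      show "indicator {y \<in> space (N k). c < \<eta> k y} y \<le> (\<eta> k y / c) powr p * indicator {c<..} (\<eta> k y)" for y
        using c p by (auto simp: indicator_def intro!: ge_one_powr_ge_zero)
    qed
    finally show ?thesis .
  qed

  have S_tail: "prob {\<omega> \<in> space M. x \<le> s * S \<omega> \<and> (\<forall>k\<in>{1..n}. \<eta> k (\<epsilon> k \<omega>) \<le> c)}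
      \<le> exp (- (h * x) + exp p * h\<^sup>2 * V / 2 + exp_excess p (h * c) * (\<alpha> - (\<Sum>k=1..n. \<tau> k))
          + h * c * (\<Sum>k=1..n. \<tau> k))"
    if h: "0 < h" and s: "\<bar>s\<bar> = 1" for h s :: real
  proof -
    define B where "B = {\<omega> \<in> space M. x \<le> s * S \<omega> \<and> (\<forall>k\<in>{1..n}. \<eta> k (\<epsilon> k \<omega>) \<le> c)}"
    define w where "w = (\<lambda>k e y. ennreal (exp (h * (s * D k e y)) * indicator {..c} (\<eta> k y)))"
    define m where "m = (\<lambda>k. exp p * h\<^sup>2 / 2 * v k + exp_excess p (h * c) * (A k / c powr p - \<tau> k) + h * c * \<tau> k)"
    define W where "W = (\<lambda>\<omega>. \<Prod>k=1..n. w k (\<lambda>j\<in>{1..<k}. \<epsilon> j \<omega>) (\<epsilon> k \<omega>))"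
    have B [measurable]: "B \<in> sets M"
    proof -
      have "{\<omega> \<in> space M. \<eta> k (\<epsilon> k \<omega>) \<le> c} \<in> sets M" if "k \<in> {1..n}" for k
        using measurable_compose[OF \<epsilon> \<eta>] that by measurable
      then show ?thesis unfolding B_def by measurable
    qed
    have w_meas: "(\<lambda>(e, y). w k e y) \<in> borel_measurable ((\<Pi>\<^sub>M j\<in>{1..<k}. N j) \<Otimes>\<^sub>M N k)"
      if k: "k \<in> {1..n}" for k
    proof -
      note [measurable] = \<eta>[OF k] D[OF k]
      show ?thesis unfolding w_def by measurable
    qed
    have w_le: "(\<integral>\<^sup>+y. w k e y \<partial>distr M (N k) (\<epsilon> k)) \<le> ennreal (exp (m k))"
      if k: "k \<in> {1..n}" and e: "e \<in> space (\<Pi>\<^sub>M j\<in>{1..<k}. N j)" for k e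
    proof -
      interpret P: prob_space "P k" by (rule P[OF k])
      have "D k e \<in> borel_measurable (P k)"
        using measurable_Pair2[OF D[OF k] e] by (simp add: P_def)
      moreover have "\<bar>s * D k e y\<bar> \<le> \<eta> k y" if "y \<in> space (P k)" for y
        using D_le[OF k e] that s by (simp add: abs_mult P_def)
      moreover have "P.expectation (\<lambda>y. s * D k e y) = 0"
        using centered[OF k e] by (simp add: P_def)
      ultimately show ?thesis
        using P.truncated_mgf_le[OF p c h, of "\<lambda>y. s * D k e y" "\<eta> k" "v k" "A k"]
          \<eta>P[OF k] sq[OF k] pow[OF k]
        by (simp add: w_def m_def \<tau>_def P_def)
    qed
    \<comment> \<open>Chernoff's bound: on \<open>B\<close> every indicator inside \<open>W\<close>
      equals 1, and off \<open>B\<close> nonnegativity suffices.\<close>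
    have "ennreal (exp (h * x)) * emeasure M B = (\<integral>\<^sup>+\<omega>. ennreal (exp (h * x)) * indicator B \<omega> \<partial>M)"
      by (simp add: nn_integral_cmult_indicator)
    also have "\<dots> \<le> (\<integral>\<^sup>+\<omega>. W \<omega> \<partial>M)"
    proof (intro nn_integral_mono)
      fix \<omega>
      show "ennreal (exp (h * x)) * indicator B \<omega> \<le> W \<omega>"
      proof (cases "\<omega> \<in> B")
        case True
        have "W \<omega> = (\<Prod>k=1..n. ennreal (exp (h * (s * D k (\<lambda>j\<in>{1..<k}. \<epsilon> j \<omega>) (\<epsilon> k \<omega>)))))"
          unfolding W_def w_def using True by (intro prod.cong) (auto simp: B_def)
        also have "\<dots> = ennreal (exp (h * (s * S \<omega>)))"
          by (simp add: S_def sum_distrib_left exp_sum prod_ennreal)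
        finally show ?thesis using True h by (simp add: B_def ennreal_leI)
      qed simp
    qed
    also have "\<dots> \<le> (\<Prod>k=1..n. ennreal (exp (m k)))"
      unfolding W_def by (intro nn_integral_prod_past_le[OF indep] w_meas w_le)
    also have "\<dots> = ennreal (exp (\<Sum>k=1..n. m k))"
      by (simp add: exp_sum prod_ennreal)
    finally have "exp (h * x) * prob B \<le> exp (\<Sum>k=1..n. m k)"
      by (simp add: emeasure_eq_measure flip: ennreal_mult)
    then have "prob B \<le> exp (- (h * x) + (\<Sum>k=1..n. m k))"
      by (simp add: exp_diff pos_le_divide_eq mult.commute)
    also have "(\<Sum>k=1..n. m k) = exp p * h\<^sup>2 * V / 2
        + exp_excess p (h * c) * (\<alpha> - (\<Sum>k=1..n. \<tau> k)) + h * c * (\<Sum>k=1..n. \<tau> k)"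
      by (simp add: m_def V_def \<alpha>_def sum.distrib sum_subtractf flip: sum_distrib_left sum_divide_distrib)
    finally show ?thesis unfolding B_def by (simp only: add.assoc)
  qed

  have \<alpha>_eq: "(1 + 2 / p) powr p * ((\<Sum>k=1..n. A k) / x powr p) = \<alpha>"
  proof -
    have "1 + 2 / p = (p + 2) / p" using p by (simp add: field_simps)
    then show ?thesis by (simp add: \<alpha>_def c_def powr_divide powr_mult)
  qed
  have "prob {\<omega> \<in> space M. x \<le> \<bar>S \<omega>\<bar>} \<le> 2 * \<alpha> + 2 * exp (- (2 / ((p + 2)\<^sup>2 * exp p) * (x\<^sup>2 / V)))"
  \<comment> \<open>For \<open>\<alpha> \<ge> 1\<close> the bound exceeds 1 and is trivial;
    otherwise \<open>ln (1 / \<alpha>)\<close> is positive, as the optimization needs.\<close>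
  proof (cases "\<alpha> < 1")
    case False
    have "prob {\<omega> \<in> space M. x \<le> \<bar>S \<omega>\<bar>} \<le> 1" by simp
    also have "\<dots> \<le> 2 * \<alpha>" using False by simp
    finally show ?thesis by (simp add: add_increasing2)
  next
    case True
    let ?\<tau> = "\<Sum>k=1..n. \<tau> k"
    have "0 \<le> ?\<tau>" by (intro sum_nonneg \<tau>_nonneg)
    moreover have "?\<tau> \<le> \<alpha>"
      unfolding \<alpha>_def sum_divide_distrib by (intro sum_mono \<tau>_le)
    ultimately obtain h where h: "0 < h"
      "?\<tau> / 2 + exp (- (h * x) + exp p * h\<^sup>2 * V / 2 + exp_excess p (h * c) * (\<alpha> - ?\<tau>) + h * c * ?\<tau>)
       \<le> \<alpha> + exp (- (2 / ((p + 2)\<^sup>2 * exp p) * (x\<^sup>2 / V)))"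
      using fuk_nagaev_optimization[OF p x V _ _ \<alpha> True] unfolding c_def by metis
    define U where "U = (\<lambda>k. {\<omega> \<in> space M. c < \<eta> k (\<epsilon> k \<omega>)})"
    define B where "B = (\<lambda>s. {\<omega> \<in> space M. x \<le> s * S \<omega> \<and> (\<forall>k\<in>{1..n}. \<eta> k (\<epsilon> k \<omega>) \<le> c)})"
    have U: "U k \<in> sets M" if "k \<in> {1..n}" for k
      unfolding U_def using measurable_compose[OF \<epsilon> \<eta>] that by measurable
    have U': "{\<omega> \<in> space M. \<eta> k (\<epsilon> k \<omega>) \<le> c} \<in> sets M" if "k \<in> {1..n}" for k
      using measurable_compose[OF \<epsilon> \<eta>] that by measurable
    have B: "B s \<in> sets M" for s :: real
      unfolding B_def using U' by measurable
    have "{\<omega> \<in> space M. x \<le> \<bar>S \<omega>\<bar>} \<subseteq> (\<Union>k\<in>{1..n}. U k) \<union> (B 1 \<union> B (- 1))"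
      by (auto simp: U_def B_def not_less abs_if split: if_splits)
    then have "prob {\<omega> \<in> space M. x \<le> \<bar>S \<omega>\<bar>} \<le> prob ((\<Union>k\<in>{1..n}. U k) \<union> (B 1 \<union> B (- 1)))"
      using U B by (intro finite_measure_mono) auto
    also have "\<dots> \<le> prob (\<Union>k\<in>{1..n}. U k) + (prob (B 1) + prob (B (- 1)))"
      using U B by (intro order_trans[OF measure_Un_le] add_left_mono measure_Un_le) auto
    also have "prob (\<Union>k\<in>{1..n}. U k) \<le> (\<Sum>k=1..n. prob (U k))"
      using U by (intro finite_measure_subadditive_finite) auto
    also have "\<dots> \<le> ?\<tau>"
      using tail by (intro sum_mono) (simp add: U_def)
    finally have "prob {\<omega> \<in> space M. x \<le> \<bar>S \<omega>\<bar>} \<le> ?\<tau> + (prob (B 1) + prob (B (- 1)))"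
      by simp
    also have "\<dots> \<le> 2 * (?\<tau> / 2 + exp (- (h * x) + exp p * h\<^sup>2 * V / 2
        + exp_excess p (h * c) * (\<alpha> - ?\<tau>) + h * c * ?\<tau>))"
      using S_tail[OF h(1), of 1] S_tail[OF h(1), of "- 1"] unfolding B_def by simp
    also have "\<dots> \<le> 2 * (\<alpha> + exp (- (2 / ((p + 2)\<^sup>2 * exp p) * (x\<^sup>2 / V))))"
      using h(2) by (intro mult_left_mono) auto
    finally show ?thesis by (simp only: distrib_left)
  qed
  then show ?thesis using \<alpha>_eq by (simp add: V_def mult.assoc)
qed

text \<open>Positive and negative parts are integrated separately as nonnegative functions. For each
  frozen past their integrals are finite and differ by the vanishing mean, so they agree, and the
  agreement survives averaging over the past.\<close>

lemma (in prob_space) centered_past_present: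
  fixes \<epsilon> :: "nat \<Rightarrow> 'a \<Rightarrow> 'y" and D :: "(nat \<Rightarrow> 'y) \<Rightarrow> 'y \<Rightarrow> real" and \<eta> :: "'y \<Rightarrow> real"
  assumes indep: "indep_vars N \<epsilon> {1..n}" and k: "k \<in> {1..n}"
    and D: "(\<lambda>(e, y). D e y) \<in> borel_measurable ((\<Pi>\<^sub>M j\<in>{1..<k}. N j) \<Otimes>\<^sub>M N k)"
    and \<eta>: "\<eta> \<in> borel_measurable (N k)"
    and D_le: "\<And>e y. e \<in> space (\<Pi>\<^sub>M j\<in>{1..<k}. N j) \<Longrightarrow> y \<in> space (N k) \<Longrightarrow> \<bar>D e y\<bar> \<le> \<eta> y"
    and centered: "\<And>e. e \<in> space (\<Pi>\<^sub>M j\<in>{1..<k}. N j) \<Longrightarrow> (\<integral>y. D e y \<partial>distr M (N k) (\<epsilon> k)) = 0"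
    and \<eta>_int: "integrable M (\<lambda>\<omega>. \<eta> (\<epsilon> k \<omega>))"
  shows "integrable M (\<lambda>\<omega>. D (\<lambda>j\<in>{1..<k}. \<epsilon> j \<omega>) (\<epsilon> k \<omega>))"
    and "expectation (\<lambda>\<omega>. D (\<lambda>j\<in>{1..<k}. \<epsilon> j \<omega>) (\<epsilon> k \<omega>)) = 0"
proof -
  define T where "T = (\<lambda>\<omega>. \<lambda>j\<in>{1..<k}. \<epsilon> j \<omega>)"
  have \<epsilon>: "\<epsilon> j \<in> M \<rightarrow>\<^sub>M N j" if "j \<in> {1..n}" for j
    using indep that by (simp add: indep_vars_def)
  have T: "T \<in> M \<rightarrow>\<^sub>M (\<Pi>\<^sub>M j\<in>{1..<k}. N j)"
    unfolding T_def using k by (intro measurable_restrict \<epsilon>) auto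
  note [measurable] = \<epsilon>[OF k] \<eta> D T
  have *: "integrable M (\<lambda>\<omega>. D (T \<omega>) (\<epsilon> k \<omega>))"
  proof (rule Bochner_Integration.integrable_bound[OF \<eta>_int])
    show "AE \<omega> in M. norm (D (T \<omega>) (\<epsilon> k \<omega>)) \<le> norm (\<eta> (\<epsilon> k \<omega>))"
      using D_le measurable_space[OF T] measurable_space[OF \<epsilon>[OF k]] by (intro AE_I2) (simp add: order_trans[OF _ abs_ge_self])
  qed measurable
  have "(\<integral>\<^sup>+y. ennreal (D e y) \<partial>distr M (N k) (\<epsilon> k)) = (\<integral>\<^sup>+y. ennreal (- D e y) \<partial>distr M (N k) (\<epsilon> k))"
    if e: "e \<in> space (\<Pi>\<^sub>M j\<in>{1..<k}. N j)" for e
  proof -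
    let ?P = "distr M (N k) (\<epsilon> k)"
    have [measurable]: "D e \<in> borel_measurable (N k)"
      using measurable_Pair2[OF D e] by simp
    have "integrable ?P \<eta>" using \<eta>_int by (simp add: integrable_distr_eq)
    then have int: "integrable ?P (D e)"
    proof (rule Bochner_Integration.integrable_bound)
      show "AE y in ?P. norm (D e y) \<le> norm (\<eta> y)"
        using D_le[OF e] by (intro AE_I2) (simp add: order_trans[OF _ abs_ge_self])
    qed measurable
    have fin: "(\<integral>\<^sup>+y. ennreal (D e y) \<partial>?P) \<noteq> \<infinity>" "(\<integral>\<^sup>+y. ennreal (- D e y) \<partial>?P) \<noteq> \<infinity>"
      using int by (auto simp: real_integrable_def)
    have "enn2real (\<integral>\<^sup>+y. ennreal (D e y) \<partial>?P) = enn2real (\<integral>\<^sup>+y. ennreal (- D e y) \<partial>?P)"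
      using centered[OF e] real_lebesgue_integral_def[OF int] by simp
    then show ?thesis using fin by (metis ennreal_enn2real infinity_ennreal_def less_top)
  qed
  then have eq: "(\<integral>\<^sup>+y. ennreal (D (T \<omega>) y) \<partial>distr M (N k) (\<epsilon> k))
      = (\<integral>\<^sup>+y. ennreal (- D (T \<omega>) y) \<partial>distr M (N k) (\<epsilon> k))" if "\<omega> \<in> space M" for \<omega>
    using measurable_space[OF T that] .
  have nn: "(\<integral>\<^sup>+\<omega>. ennreal (G (T \<omega>) (\<epsilon> k \<omega>)) \<partial>M)
      = (\<integral>\<^sup>+\<omega>. \<integral>\<^sup>+y. ennreal (G (T \<omega>) y) \<partial>distr M (N k) (\<epsilon> k) \<partial>M)"
    if [measurable]: "(\<lambda>(e, y). G e y) \<in> borel_measurable ((\<Pi>\<^sub>M j\<in>{1..<k}. N j) \<Otimes>\<^sub>M N k)" for G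
  proof -
    have "(\<lambda>(e, y). ennreal (G e y)) \<in> borel_measurable ((\<Pi>\<^sub>M j\<in>{1..<k}. N j) \<Otimes>\<^sub>M N k)"
      by measurable
    from nn_integral_past_present[OF indep k this] show ?thesis
      unfolding T_def by (simp only: prod.case)
  qed
  have "(\<integral>\<^sup>+\<omega>. ennreal (D (T \<omega>) (\<epsilon> k \<omega>)) \<partial>M)
      = (\<integral>\<^sup>+\<omega>. \<integral>\<^sup>+y. ennreal (D (T \<omega>) y) \<partial>distr M (N k) (\<epsilon> k) \<partial>M)"
    by (rule nn) measurable
  also have "\<dots> = (\<integral>\<^sup>+\<omega>. \<integral>\<^sup>+y. ennreal (- D (T \<omega>) y) \<partial>distr M (N k) (\<epsilon> k) \<partial>M)"
    by (intro nn_integral_cong eq)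
  also have "\<dots> = (\<integral>\<^sup>+\<omega>. ennreal (- D (T \<omega>) (\<epsilon> k \<omega>)) \<partial>M)"
    by (rule nn[symmetric]) measurable
  finally have "(\<integral>\<^sup>+\<omega>. ennreal (D (T \<omega>) (\<epsilon> k \<omega>)) \<partial>M) = (\<integral>\<^sup>+\<omega>. ennreal (- D (T \<omega>) (\<epsilon> k \<omega>)) \<partial>M)" .
  then have "expectation (\<lambda>\<omega>. D (T \<omega>) (\<epsilon> k \<omega>)) = 0"
    using real_lebesgue_integral_def[OF *] by simp
  with * show "integrable M (\<lambda>\<omega>. D (\<lambda>j\<in>{1..<k}. \<epsilon> j \<omega>) (\<epsilon> k \<omega>))"
    and "expectation (\<lambda>\<omega>. D (\<lambda>j\<in>{1..<k}. \<epsilon> j \<omega>) (\<epsilon> k \<omega>)) = 0"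
    by (simp_all add: T_def)
qed

section \<open>The martingale decomposition of the chain\<close>

lemma measurable_dist_const [measurable]: "dist (z :: 'a :: metric_space) \<in> borel_measurable borel"
  by (intro borel_measurable_continuous_onI continuous_on_dist continuous_on_const continuous_on_id)

lemma measurable_mean_dist:
  fixes P :: "'y::polish_space measure"
  assumes "sigma_finite_measure P" "sets P = sets borel"
  shows "mean_dist P \<in> borel_measurable borel"
proof -
  interpret P: sigma_finite_measure P by fact
  have "(\<lambda>(y, y'). ennreal (dist y y')) \<in> borel_measurable (borel \<Otimes>\<^sub>M P)"
    using assms(2) by (simp cong: measurable_cong_sets add: sets_pair_measure_cong[OF refl assms(2)])
  then show ?thesis unfolding mean_dist_def by (intro P.borel_measurable_nn_integral)
qed

text \<open>Used to carry finiteness of the mean distance from one point to all points.\<close>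

lemma mean_dist_triangle:
  assumes "prob_space P" "sets P = sets borel"
  shows "mean_dist P y \<le> ennreal (dist y z) + mean_dist P z"
proof -
  interpret P: prob_space P by fact
  have "mean_dist P y \<le> (\<integral>\<^sup>+y'. ennreal (dist y z) + ennreal (dist z y') \<partial>P)"
    unfolding mean_dist_def
    by (intro nn_integral_mono) (simp add: dist_triangle flip: ennreal_plus)
  also have "\<dots> = ennreal (dist y z) + mean_dist P z"
    unfolding mean_dist_def using assms(2)
    by (subst nn_integral_add) (auto cong: measurable_cong_sets simp: P.emeasure_space_1)
  finally show ?thesis .
qed

lemma measurable_case_nat_history:
  assumes "g \<in> N \<rightarrow>\<^sub>M borel" "h \<in> N \<rightarrow>\<^sub>M (\<Pi>\<^sub>M j\<in>(UNIV :: nat set). borel)"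
  shows "(\<lambda>z. case_nat (g z) (h z)) \<in> N \<rightarrow>\<^sub>M (\<Pi>\<^sub>M j\<in>(UNIV :: nat set). borel)"
proof (rule measurable_abs_UNIV[where f = "\<lambda>j z. case_nat (g z) (h z) j", simplified])
  show "(\<lambda>z. case j of 0 \<Rightarrow> g z | Suc i \<Rightarrow> h z i) \<in> N \<rightarrow>\<^sub>M borel" for j
    using assms measurable_compose[OF assms(2) measurable_component_singleton] by (cases j) auto
qed

text \<open>The Lipschitz constant of the conditional mean, \<open>r\<close> steps before the end, in the state
  \<open>j\<close> steps before the current one; integrating out one more innovation replaces the current state
  by the contraction bound, which gives the recursion below.\<close>

definition lip_coeff :: "(nat \<Rightarrow> real) \<Rightarrow> nat \<Rightarrow> nat \<Rightarrow> real" where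
  "lip_coeff a r j = 1 + (\<Sum>l<r. diag_coeff a l * a (r - l + j))"

lemma lip_coeff_0: "lip_coeff a 0 j = 1"
  by (simp add: lip_coeff_def)

lemma lip_coeff_Suc: "lip_coeff a (Suc r) j = lip_coeff a r (Suc j) + diag_coeff a r * a (Suc j)"
proof -
  have "(\<Sum>l<r. diag_coeff a l * a (Suc r - l + j)) = (\<Sum>l<r. diag_coeff a l * a (r - l + Suc j))"
    by (intro sum.cong refl) (simp add: Suc_diff_le)
  then show ?thesis by (simp add: lip_coeff_def)
qed

text \<open>At lag 0 the solved recursion is the defining recursion of \<open>diag_coeff\<close>;
  the index \<open>l = 0\<close> supplies its separate summand \<open>a (Suc k)\<close>.\<close>

lemma lip_coeff_at_0: "lip_coeff a r 0 = diag_coeff a r"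
proof (cases r)
  case (Suc k)
  have "(\<Sum>l<Suc k. diag_coeff a l * a (Suc k - l))
      = a (Suc k) + (\<Sum>l=1..k. diag_coeff a l * a (Suc k - l))"
    by (simp only: lessThan_atLeast0 atLeast0LessThan[symmetric] atLeastLessThanSuc_atLeastAtMost
        sum.atLeast_Suc_atMost) (simp add: sum.atLeast_Suc_atMost)
  then show ?thesis by (simp add: Suc lip_coeff_def)
qed (simp add: lip_coeff_0)

lemma diag_coeff_ge_1:
  assumes "\<And>i. i \<ge> 1 \<Longrightarrow> 0 \<le> a i"
  shows "1 \<le> diag_coeff a k"
proof (induction k rule: less_induct)
  case (less k)
  show ?case
  proof (cases k)
    case (Suc i)
    have "0 \<le> (\<Sum>l=1..i. diag_coeff a l * a (Suc i - l))"
      using less.IH assms Suc by (intro sum_nonneg mult_nonneg_nonneg) (auto intro: order_trans[OF zero_le_one])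
    then show ?thesis using assms[of "Suc i"] by (simp add: Suc)
  qed simp
qed

section \<open>Conditional means as functions of the history\<close>

locale lipschitz_memory_chain = infinite_memory_chain M \<epsilon> F a past X
  for M :: "'w measure"
    and \<epsilon> :: "nat \<Rightarrow> 'w \<Rightarrow> 'y::polish_space"
    and F :: "nat \<Rightarrow> (nat \<Rightarrow> 'x::polish_space) \<Rightarrow> 'y \<Rightarrow> 'x"
    and a :: "nat \<Rightarrow> real"
    and past :: "int \<Rightarrow> 'x"
    and X :: "int \<Rightarrow> 'w \<Rightarrow> 'x" +
  fixes n :: nat and f :: "(nat \<Rightarrow> 'x) \<Rightarrow> real"
  assumes f_Lipschitz: "separately_Lipschitz n f"
    and F_Lipschitz: "\<And>m z y y'. m \<ge> 1 \<Longrightarrow> dist (F m z y) (F m z y') \<le> dist y y'"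
    and mean_dist_finite: "\<And>k y. k \<in> {1..n} \<Longrightarrow> mean_dist (distr M borel (\<epsilon> k)) y < \<infinity>"
begin

abbreviation law :: "nat \<Rightarrow> 'y measure" where
  "law k \<equiv> distr M borel (\<epsilon> k)"

abbreviation histories :: "(nat \<Rightarrow> 'x) measure" where
  "histories \<equiv> \<Pi>\<^sub>M j\<in>UNIV. borel"

lemma innovation_measurable: "1 \<le> k \<Longrightarrow> \<epsilon> k \<in> M \<rightarrow>\<^sub>M borel"
  using indep_innovations by (simp add: indep_vars_def)

lemma law_prob_space: "1 \<le> k \<Longrightarrow> prob_space (law k)"
  by (intro prob_space_distr innovation_measurable)

text \<open>Position 0 holds the state at time \<open>k\<close>, so that \<open>F (Suc k)\<close>
  reads the history unshifted. Depending on innovations instead of sample points, it can be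
  evaluated on a frozen past.\<close>

primrec hist :: "(nat \<Rightarrow> 'y) \<Rightarrow> nat \<Rightarrow> nat \<Rightarrow> 'x" where
  "hist e 0 = (\<lambda>j. past (- int j))"
| "hist e (Suc k) = case_nat (F (Suc k) (hist e k) (e (Suc k))) (hist e k)"

text \<open>\<open>cond_mean r H\<close> is the conditional mean of \<open>f(X\<^sub>1, \<dots>, X\<^sub>n)\<close> when the chain has history
  \<open>H\<close> (most recent state first) at time \<open>n - r\<close>.\<close>

primrec cond_mean :: "nat \<Rightarrow> (nat \<Rightarrow> 'x) \<Rightarrow> real" where
  "cond_mean 0 H = f (\<lambda>i\<in>{1..n}. H (n - i))"
| "cond_mean (Suc r) H = (\<integral>y. cond_mean r (case_nat (F (n - r) H y) H) \<partial>law (n - r))"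

lemma hist_eq_chain:
  assumes "\<omega> \<in> space M" "\<And>j. j \<in> {1..k} \<Longrightarrow> e j = \<epsilon> j \<omega>"
  shows "hist e k = (\<lambda>j. X (int k - int j) \<omega>)"
  using assms(2)
proof (induction k)
  case 0
  then show ?case using X_past[of "- int j" \<omega> for j] assms(1) by simp
next
  case (Suc k)
  then have IH: "hist e k = (\<lambda>j. X (int k - int j) \<omega>)" by simp
  show ?case
  proof
    fix j
    show "hist e (Suc k) j = X (int (Suc k) - int j) \<omega>"
      using IH Suc.prems X_step[of "Suc k" \<omega>] assms(1) by (cases j) simp_all
  qed
qed

lemma F_measurable':
  assumes "1 \<le> m" "g \<in> N \<rightarrow>\<^sub>M histories" "h \<in> N \<rightarrow>\<^sub>M borel"
  shows "(\<lambda>z. F m (g z) (h z)) \<in> N \<rightarrow>\<^sub>M borel"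
  using measurable_compose[OF measurable_Pair[OF assms(2,3)] F_measurable[OF assms(1)]] by simp

lemma hist_measurable:
  "i < k \<Longrightarrow> (\<lambda>e. hist e i) \<in> (\<Pi>\<^sub>M j\<in>{1..<k}. borel) \<rightarrow>\<^sub>M histories"
proof (induction i)
  case (Suc i)
  then have "(\<lambda>e. F (Suc i) (hist e i) (e (Suc i))) \<in> (\<Pi>\<^sub>M j\<in>{1..<k}. borel) \<rightarrow>\<^sub>M borel"
    by (intro F_measurable' measurable_component_singleton) auto
  then show ?case using Suc by (simp add: measurable_case_nat_history)
qed (simp add: space_PiM measurable_const)

lemma cond_mean_0_Lipschitz:
  "\<bar>cond_mean 0 H - cond_mean 0 H'\<bar> \<le> (\<Sum>j<n. dist (H j) (H' j))"
proof -
  have ext: "(\<lambda>i\<in>{1..n}. H (n - i)) \<in> {1..n} \<rightarrow>\<^sub>E UNIV" for H :: "nat \<Rightarrow> 'x" by simp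
  have "\<bar>cond_mean 0 H - cond_mean 0 H'\<bar> \<le> (\<Sum>i=1..n. dist ((\<lambda>i\<in>{1..n}. H (n - i)) i) ((\<lambda>i\<in>{1..n}. H' (n - i)) i))"
    unfolding cond_mean.simps
    by (rule f_Lipschitz[unfolded separately_Lipschitz_def, THEN bspec, THEN bspec, OF ext ext])
  also have "\<dots> = (\<Sum>i=1..n. dist (H (n - i)) (H' (n - i)))" by simp
  also have "\<dots> = (\<Sum>j<n. dist (H j) (H' j))"
    by (rule sum.reindex_bij_witness[of _ "\<lambda>j. n - j" "\<lambda>i. n - i"]) auto
  finally show ?thesis .
qed

lemma cond_mean_measurable: "r \<le> n \<Longrightarrow> cond_mean r \<in> borel_measurable histories"
proof (induction r)
  case 0
  \<comment> \<open>Measurability of \<open>f\<close> comes from its Lipschitz bound: only finitely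
    many coordinates enter, which gives continuity in the product topology, and its Borel sets form
    the product sigma-algebra.\<close>
  have "continuous_on UNIV (cond_mean 0)"
    unfolding continuous_on_def
  proof safe
    fix H :: "nat \<Rightarrow> 'x"
    have "((\<lambda>H'. \<Sum>j<n. dist (H' j) (H j)) \<longlongrightarrow> (\<Sum>j<n. dist (H j) (H j))) (at H)"
    proof (intro tendsto_sum tendsto_dist tendsto_const)
      show "((\<lambda>H'. H' j) \<longlongrightarrow> H j) (at H)" for j
        by (rule continuous_on_product_coordinates[unfolded continuous_on_def, THEN bspec, OF UNIV_I])
    qed
    then have "((\<lambda>H'. \<Sum>j<n. dist (H' j) (H j)) \<longlongrightarrow> 0) (at H)" by simp
    then have "((\<lambda>H'. cond_mean 0 H' - cond_mean 0 H) \<longlongrightarrow> 0) (at H)"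
      by (rule Lim_null_comparison[rotated]) (simp only: real_norm_def cond_mean_0_Lipschitz eventually_True)
    then show "(cond_mean 0 \<longlongrightarrow> cond_mean 0 H) (at H)" by (simp only: LIM_zero_cancel)
  qed
  then have "cond_mean 0 \<in> borel_measurable borel" by (rule borel_measurable_continuous_onI)
  then show ?case by (simp only: measurable_cong_sets[OF sets_PiM_equal_borel refl])
next
  case (Suc r)
  have m: "1 \<le> n - r" using Suc.prems by simp
  interpret P: prob_space "law (n - r)" by (rule law_prob_space[OF m])
  have "(\<lambda>z. cond_mean r (case_nat (F (n - r) (fst z) (snd z)) (fst z))) \<in> borel_measurable (histories \<Otimes>\<^sub>M law (n - r))"
    using Suc m
    by (intro measurable_compose[OF _ Suc.IH] measurable_case_nat_history F_measurable') (auto cong: measurable_cong_sets)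
  then have "(\<lambda>H. \<integral>y. cond_mean r (case_nat (F (n - r) H y) H) \<partial>law (n - r)) \<in> borel_measurable histories"
    by (intro P.borel_measurable_lebesgue_integral) (simp add: case_prod_unfold)
  then show ?case by (simp add: fun_eq_iff[symmetric] cong: measurable_cong)
qed

lemma dist_law_integrable:
  assumes "k \<in> {1..n}"
  shows "integrable (law k) (dist y)" "(\<integral>y'. dist y y' \<partial>law k) = enn2real (mean_dist (law k) y)"
proof -
  have "(\<integral>\<^sup>+y'. ennreal (dist y y') \<partial>law k) < \<infinity>"
    using mean_dist_finite[OF assms] by (simp add: mean_dist_def)
  then show "integrable (law k) (dist y)"
    by (intro integrableI_nonneg) auto
  show "(\<integral>y'. dist y y' \<partial>law k) = enn2real (mean_dist (law k) y)"
    unfolding mean_dist_def by (intro integral_eq_nn_integral) auto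
qed

lemma measurable_step:
  assumes "r < n"
  shows "(\<lambda>y. cond_mean r (case_nat (F (n - r) H y) H)) \<in> borel_measurable borel"
  using assms
  by (intro measurable_compose[OF _ cond_mean_measurable] measurable_case_nat_history F_measurable')
     (auto simp: space_PiM intro!: measurable_const)

text \<open>At time \<open>n - r\<close> the positions from \<open>n - r\<close> on hold times up to
  0. Comparing only histories with a common initial past keeps all sums finite.\<close>

abbreviation (input) Lipschitz_at :: "nat \<Rightarrow> bool" where
  "Lipschitz_at r \<equiv> \<forall>H H'. (\<forall>j\<ge>n - r. H j = H' j) \<longrightarrow>
    \<bar>cond_mean r H - cond_mean r H'\<bar> \<le> (\<Sum>j<n - r. lip_coeff a r j * dist (H j) (H' j))"

lemma step_Lipschitz:
  assumes "Lipschitz_at r" "r < n" "\<And>j. n - Suc r \<le> j \<Longrightarrow> H j = H' j"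
  shows "\<bar>cond_mean r (case_nat u H) - cond_mean r (case_nat u' H')\<bar>
    \<le> diag_coeff a r * dist u u' + (\<Sum>j<n - Suc r. lip_coeff a r (Suc j) * dist (H j) (H' j))"
proof -
  have n: "n - r = Suc (n - Suc r)" using assms(2) by simp
  have "case_nat u H j = case_nat u' H' j" if "n - r \<le> j" for j
    using that assms(3) n by (cases j) auto
  then have "\<bar>cond_mean r (case_nat u H) - cond_mean r (case_nat u' H')\<bar>
      \<le> (\<Sum>j<n - r. lip_coeff a r j * dist (case_nat u H j) (case_nat u' H' j))"
    using assms(1) by blast
  also have "\<dots> = diag_coeff a r * dist u u' + (\<Sum>j<n - Suc r. lip_coeff a r (Suc j) * dist (H j) (H' j))"
    unfolding n sum.lessThan_Suc_shift by (simp add: lip_coeff_at_0)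
  finally show ?thesis .
qed

lemma step_Lipschitz_same:
  assumes "Lipschitz_at r" "r < n"
  shows "\<bar>cond_mean r (case_nat u H) - cond_mean r (case_nat u' H)\<bar> \<le> diag_coeff a r * dist u u'"
  using step_Lipschitz[OF assms, of H H u u'] by simp

lemma diag_coeff_pos: "0 < diag_coeff a r"
  using diag_coeff_ge_1[of a r] a_nonneg by force

lemma step_integrable:
  assumes "Lipschitz_at r" "r < n"
  shows "integrable (law (n - r)) (\<lambda>y. cond_mean r (case_nat (F (n - r) H y) H))"
proof -
  define k where "k = n - r"
  have k: "k \<in> {1..n}" using assms(2) by (auto simp: k_def)
  interpret P: prob_space "law k" using k by (intro law_prob_space) simp
  \<comment> \<open>An arbitrary reference innovation: the step function differs from its value
    there by at most a multiple of \<open>dist y0\<close>, which is integrable.\<close>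
  fix y0 :: 'y
  let ?g = "\<lambda>y. cond_mean r (case_nat (F k H y) H)"
  have "integrable (law k) (\<lambda>y. \<bar>?g y0\<bar> + diag_coeff a r * dist y0 y)"
    using dist_law_integrable[OF k] by auto
  then have "integrable (law k) ?g"
  proof (rule Bochner_Integration.integrable_bound)
    show "?g \<in> borel_measurable (law k)"
      using measurable_step[OF assms(2)] by (simp add: k_def)
    show "AE y in law k. norm (?g y) \<le> norm (\<bar>?g y0\<bar> + diag_coeff a r * dist y0 y)"
    proof (rule AE_I2)
      fix y
      have "\<bar>?g y0 - ?g y\<bar> \<le> diag_coeff a r * dist (F k H y0) (F k H y)"
        by (rule step_Lipschitz_same[OF assms])
      also have "\<dots> \<le> diag_coeff a r * dist y0 y"
        using k F_Lipschitz less_imp_le[OF diag_coeff_pos] by (intro mult_left_mono) auto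
      finally show "norm (?g y) \<le> norm (\<bar>?g y0\<bar> + diag_coeff a r * dist y0 y)" by simp
    qed
  qed
  then show ?thesis by (simp add: k_def)
qed

text \<open>Agreement of the distant pasts cuts the contraction series to a finite sum, which makes
  the \<open>ennreal\<close> bound finite and transfers it to a Bochner integral.\<close>

lemma contraction_integral:
  assumes "1 \<le> m" "\<And>j. k \<le> j \<Longrightarrow> H j = H' j"
  shows "integrable (law m) (\<lambda>y. dist (F m H y) (F m H' y))"
    and "(\<integral>y. dist (F m H y) (F m H' y) \<partial>law m) \<le> (\<Sum>j<k. a (Suc j) * dist (H j) (H' j))"
proof -
  let ?d = "\<lambda>y. dist (F m H y) (F m H' y)"
  let ?s = "\<Sum>j<k. a (Suc j) * dist (H j) (H' j)"
  have [measurable]: "F m G \<in> borel \<rightarrow>\<^sub>M borel" for G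
    using F_measurable'[OF assms(1), of "\<lambda>_. G" borel "\<lambda>y. y"] by (simp add: space_PiM)
  note [measurable] = innovation_measurable[OF assms(1)]
  have s: "0 \<le> ?s" using a_nonneg by (intro sum_nonneg) auto
  have "(\<integral>\<^sup>+y. ennreal (?d y) \<partial>law m) = (\<integral>\<^sup>+\<omega>. ennreal (?d (\<epsilon> m \<omega>)) \<partial>M)"
    by (intro nn_integral_distr) auto
  also have "\<dots> \<le> (\<Sum>j. ennreal (a (Suc j) * dist (H j) (H' j)))"
    by (rule contraction[OF assms(1)])
  also have "\<dots> = (\<Sum>j<k. ennreal (a (Suc j) * dist (H j) (H' j)))"
    using assms(2) by (intro suminf_finite) auto
  also have "\<dots> = ennreal ?s"
    using a_nonneg by (intro sum_ennreal) auto
  finally have le: "(\<integral>\<^sup>+y. ennreal (?d y) \<partial>law m) \<le> ennreal ?s" .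
  then show int: "integrable (law m) ?d"
    by (intro integrableI_nonneg) (auto simp: le_less_trans)
  show "(\<integral>y. ?d y \<partial>law m) \<le> ?s"
    using le nn_integral_eq_integral[OF int] s by (simp add: ennreal_le_iff)
qed

lemma cond_mean_Lipschitz: "r \<le> n \<Longrightarrow> Lipschitz_at r"
proof (induction r)
  case 0
  then show ?case using cond_mean_0_Lipschitz by (simp only: lip_coeff_0 diff_zero mult_1) blast
next
  case (Suc r)
  then have IH: "Lipschitz_at r" and r: "r < n" by auto
  define k where "k = n - Suc r"
  have m: "1 \<le> n - r" using r by simp
  interpret P: prob_space "law (n - r)" by (rule law_prob_space[OF m])
  have prob [simp]: "P.prob UNIV = 1" using P.prob_space by simp
  show ?case
  proof (intro allI impI)
    fix H H' :: "nat \<Rightarrow> 'x"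
    assume "\<forall>j\<ge>n - Suc r. H j = H' j"
    then have eq: "H j = H' j" if "k \<le> j" for j using that by (simp add: k_def)
    let ?g = "\<lambda>H y. cond_mean r (case_nat (F (n - r) H y) H)"
    let ?d = "\<lambda>y. dist (F (n - r) H y) (F (n - r) H' y)"
    let ?s = "\<Sum>j<k. lip_coeff a r (Suc j) * dist (H j) (H' j)"
    note int = step_integrable[OF IH r]
    note contr = contraction_integral[where H = H and H' = H' and k = k, OF m eq]
    \<comment> \<open>Both histories are driven by the same innovation \<open>y\<close>; this
      coupling lets the contraction in mean act under the integral.\<close>
    have "\<bar>cond_mean (Suc r) H - cond_mean (Suc r) H'\<bar> = \<bar>\<integral>y. ?g H y - ?g H' y \<partial>law (n - r)\<bar>"
      using int by simp
    also have "\<dots> \<le> (\<integral>y. \<bar>?g H y - ?g H' y\<bar> \<partial>law (n - r))"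
      by (rule integral_abs_bound)
    also have "\<dots> \<le> (\<integral>y. diag_coeff a r * ?d y + ?s \<partial>law (n - r))"
    proof (rule integral_mono)
      show "integrable (law (n - r)) (\<lambda>y. \<bar>?g H y - ?g H' y\<bar>)" using int by auto
      show "integrable (law (n - r)) (\<lambda>y. diag_coeff a r * ?d y + ?s)"
        using contr(1) by auto
      show "\<bar>?g H y - ?g H' y\<bar> \<le> diag_coeff a r * ?d y + ?s" for y
        unfolding k_def by (rule step_Lipschitz[OF IH r]) (use eq in \<open>simp add: k_def\<close>)
    qed
    also have "\<dots> = diag_coeff a r * (\<integral>y. ?d y \<partial>law (n - r)) + ?s"
      using contr(1) by simp
    also have "\<dots> \<le> diag_coeff a r * (\<Sum>j<k. a (Suc j) * dist (H j) (H' j)) + ?s"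
      using contr(2) less_imp_le[OF diag_coeff_pos]
      by (intro add_right_mono mult_left_mono) auto
    also have "\<dots> = (\<Sum>j<k. lip_coeff a (Suc r) j * dist (H j) (H' j))"
      by (simp add: lip_coeff_Suc sum_distrib_left algebra_simps flip: sum.distrib)
    finally show "\<bar>cond_mean (Suc r) H - cond_mean (Suc r) H'\<bar>
        \<le> (\<Sum>j<n - Suc r. lip_coeff a (Suc r) j * dist (H j) (H' j))"
      by (simp only: k_def)
  qed
qed

section \<open>Martingale increments and the telescoping sum\<close>

definition increment :: "nat \<Rightarrow> (nat \<Rightarrow> 'y) \<Rightarrow> 'y \<Rightarrow> real" where
  "increment k e y = cond_mean (n - k) (case_nat (F k (hist e (k - 1)) y) (hist e (k - 1)))
     - cond_mean (Suc (n - k)) (hist e (k - 1))"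

definition increment_bound :: "nat \<Rightarrow> 'y \<Rightarrow> real" where
  "increment_bound k y = diag_coeff a (n - k) * enn2real (mean_dist (law k) y)"

lemma increment_bound_measurable: "k \<in> {1..n} \<Longrightarrow> increment_bound k \<in> borel_measurable borel"
proof -
  assume "k \<in> {1..n}"
  then interpret P: prob_space "law k" by (intro law_prob_space) simp
  have [measurable]: "mean_dist (law k) \<in> borel_measurable borel"
    by (rule measurable_mean_dist) (simp_all add: P.sigma_finite_measure_axioms)
  show ?thesis unfolding increment_bound_def by measurable
qed

lemma increment_measurable:
  assumes "k \<in> {1..n}"
  shows "(\<lambda>(e, y). increment k e y) \<in> borel_measurable ((\<Pi>\<^sub>M j\<in>{1..<k}. borel) \<Otimes>\<^sub>M borel)"
proof -
  have k: "1 \<le> k" "k - 1 < k" "n - k \<le> n" "Suc (n - k) \<le> n" using assms by auto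
  have h: "(\<lambda>z. hist (fst z) (k - 1)) \<in> (\<Pi>\<^sub>M j\<in>{1..<k}. borel) \<Otimes>\<^sub>M borel \<rightarrow>\<^sub>M histories"
    by (rule measurable_compose[OF measurable_fst hist_measurable[OF k(2)]])
  show ?thesis
    unfolding increment_def case_prod_unfold
    by (intro borel_measurable_diff measurable_compose[OF _ cond_mean_measurable[OF k(3)]]
        measurable_compose[OF _ cond_mean_measurable[OF k(4)]]
        measurable_case_nat_history F_measurable'[OF k(1)] h measurable_snd)
qed

text \<open>The subtracted term is the mean of the first over an independent copy \<open>y'\<close>
  of the innovation with the same history. The increment is thus an average of differences, each at
  most a multiple of \<open>dist y y'\<close>, and averaging the distance produces
  \<open>mean_dist\<close>.\<close>

lemma
  assumes k: "k \<in> {1..n}"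
  shows increment_centered: "(\<integral>y. increment k e y \<partial>law k) = 0"
    and increment_le: "\<bar>increment k e y\<bar> \<le> increment_bound k y"
proof -
  interpret P: prob_space "law k" using k by (intro law_prob_space) simp
  have prob [simp]: "P.prob UNIV = 1" using P.prob_space by simp
  have nk: "n - (n - k) = k" "n - k < n" using k by auto
  define H where "H = hist e (k - 1)"
  let ?g = "\<lambda>y. cond_mean (n - k) (case_nat (F k H y) H)"
  have Lip: "Lipschitz_at (n - k)" by (rule cond_mean_Lipschitz) simp
  have int: "integrable (law k) ?g"
    using step_integrable[OF Lip nk(2)] by (simp only: nk)
  have inc: "increment k e y = ?g y - (\<integral>y'. ?g y' \<partial>law k)" for y
    by (simp add: increment_def H_def nk)
  show "(\<integral>y. increment k e y \<partial>law k) = 0"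
    using int by (simp add: inc)
  have "\<bar>increment k e y\<bar> = \<bar>\<integral>y'. ?g y - ?g y' \<partial>law k\<bar>"
    using int by (simp add: inc)
  also have "\<dots> \<le> (\<integral>y'. \<bar>?g y - ?g y'\<bar> \<partial>law k)"
    by (rule integral_abs_bound)
  also have "\<dots> \<le> (\<integral>y'. diag_coeff a (n - k) * dist y y' \<partial>law k)"
  proof (rule integral_mono)
    show "integrable (law k) (\<lambda>y'. \<bar>?g y - ?g y'\<bar>)" using int by auto
    show "integrable (law k) (\<lambda>y'. diag_coeff a (n - k) * dist y y')"
      using dist_law_integrable(1)[OF k] by simp
    fix y'
    have "\<bar>?g y - ?g y'\<bar> \<le> diag_coeff a (n - k) * dist (F k H y) (F k H y')"
      by (rule step_Lipschitz_same[OF Lip nk(2)])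
    also have "\<dots> \<le> diag_coeff a (n - k) * dist y y'"
      using k F_Lipschitz less_imp_le[OF diag_coeff_pos] by (intro mult_left_mono) auto
    finally show "\<bar>?g y - ?g y'\<bar> \<le> diag_coeff a (n - k) * dist y y'" .
  qed
  also have "\<dots> = increment_bound k y"
    using dist_law_integrable(2)[OF k] by (simp add: increment_bound_def)
  finally show "\<bar>increment k e y\<bar> \<le> increment_bound k y" .
qed

lemma chain_functional_eq_sum:
  assumes "\<omega> \<in> space M"
  shows "f (\<lambda>i\<in>{1..n}. X (int i) \<omega>)
    = cond_mean n (\<lambda>j. past (- int j)) + (\<Sum>k=1..n. increment k (\<lambda>j\<in>{1..<k}. \<epsilon> j \<omega>) (\<epsilon> k \<omega>))"
proof -
  define h where "h = (\<lambda>k j. X (int k - int j) \<omega>)"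
  have "increment k (\<lambda>j\<in>{1..<k}. \<epsilon> j \<omega>) (\<epsilon> k \<omega>) = cond_mean (n - k) (h k) - cond_mean (n - (k - 1)) (h (k - 1))"
    if k: "k \<in> {1..n}" for k
  proof -
    have prev: "hist (\<lambda>j\<in>{1..<k}. \<epsilon> j \<omega>) (k - 1) = h (k - 1)"
      unfolding h_def using k by (intro hist_eq_chain assms) auto
    \<comment> \<open>The restricted tuple is undefined at \<open>k\<close>, so the step from
      \<open>k - 1\<close> to \<open>k\<close> is unfolded along the full innovation
      sequence.\<close>
    have "hist (\<lambda>j. \<epsilon> j \<omega>) (k - 1) = h (k - 1)" "hist (\<lambda>j. \<epsilon> j \<omega>) k = h k"
      unfolding h_def by (rule hist_eq_chain[OF assms], simp)+
    moreover have "k = Suc (k - 1)" using k by simp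
    ultimately have "case_nat (F k (h (k - 1)) (\<epsilon> k \<omega>)) (h (k - 1)) = h k"
      using hist.simps(2)[of "\<lambda>j. \<epsilon> j \<omega>" "k - 1"] by simp
    moreover have "n - (k - 1) = Suc (n - k)" using k by auto
    ultimately show ?thesis by (simp only: increment_def prev)
  qed
  then have "(\<Sum>k=1..n. increment k (\<lambda>j\<in>{1..<k}. \<epsilon> j \<omega>) (\<epsilon> k \<omega>))
      = (\<Sum>k\<in>{Suc 0..n}. cond_mean (n - k) (h k) - cond_mean (n - (k - 1)) (h (k - 1)))"
    by (intro sum.cong) auto
  also have "\<dots> = cond_mean (n - n) (h n) - cond_mean (n - 0) (h 0)"
    by (rule sum_telescope'') simp
  also have "cond_mean (n - n) (h n) = f (\<lambda>i\<in>{1..n}. X (int i) \<omega>)"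
    by (auto simp: h_def of_nat_diff intro!: arg_cong[where f = f])
  also have "h 0 = (\<lambda>j. past (- int j))"
    using X_past assms by (simp add: h_def)
  finally have sum_eq: "(\<Sum>k=1..n. increment k (\<lambda>j\<in>{1..<k}. \<epsilon> j \<omega>) (\<epsilon> k \<omega>))
      = f (\<lambda>i\<in>{1..n}. X (int i) \<omega>) - cond_mean n (\<lambda>j. past (- int j))"
    by (simp only: diff_zero)
  show ?thesis unfolding sum_eq by simp
qed

text \<open>Integrability of the increments ensures that the expectation subtracted from the
  functional is the true mean, the constant \<open>cond_mean n\<close> at the initial past.\<close>

lemma centered_functional_eq_sum:
  assumes "\<And>k. k \<in> {1..n} \<Longrightarrow> integrable M (\<lambda>\<omega>. increment_bound k (\<epsilon> k \<omega>))" and \<omega>: "\<omega> \<in> space M"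
  shows "centered_functional M n f X \<omega> = (\<Sum>k=1..n. increment k (\<lambda>j\<in>{1..<k}. \<epsilon> j \<omega>) (\<epsilon> k \<omega>))"
proof -
  have indep: "indep_vars (\<lambda>_. borel) \<epsilon> {1..n}"
    using indep_innovations by (rule indep_vars_subset) auto
  have inc: "integrable M (\<lambda>\<omega>. increment k (\<lambda>j\<in>{1..<k}. \<epsilon> j \<omega>) (\<epsilon> k \<omega>))"
      "expectation (\<lambda>\<omega>. increment k (\<lambda>j\<in>{1..<k}. \<epsilon> j \<omega>) (\<epsilon> k \<omega>)) = 0" if k: "k \<in> {1..n}" for k
    using centered_past_present[OF indep k increment_measurable[OF k] increment_bound_measurable[OF k]
        increment_le[OF k] increment_centered[OF k] assms(1)[OF k]] by blast+
  have "expectation (\<lambda>\<omega>. f (\<lambda>i\<in>{1..n}. X (int i) \<omega>))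
      = expectation (\<lambda>\<omega>. cond_mean n (\<lambda>j. past (- int j)) + (\<Sum>k=1..n. increment k (\<lambda>j\<in>{1..<k}. \<epsilon> j \<omega>) (\<epsilon> k \<omega>)))"
    by (intro Bochner_Integration.integral_cong refl chain_functional_eq_sum)
  also have "\<dots> = cond_mean n (\<lambda>j. past (- int j))"
    using inc by (subst Bochner_Integration.integral_add) (auto simp: prob_space Bochner_Integration.integral_sum)
  finally show ?thesis
    unfolding centered_functional_def by (simp only: chain_functional_eq_sum[OF \<omega>])
qed

end

section \<open>Reduction of the deviation bound to the martingale inequality\<close>

theorem proposition4p8:
  fixes M :: "'w measure"
    and \<epsilon> :: "nat \<Rightarrow> 'w \<Rightarrow> 'y::polish_space"
    and F :: "nat \<Rightarrow> (nat \<Rightarrow> 'x::polish_space) \<Rightarrow> 'y \<Rightarrow> 'x"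
    and a :: "nat \<Rightarrow> real"
    and past :: "int \<Rightarrow> 'x"
    and X :: "int \<Rightarrow> 'w \<Rightarrow> 'x"
    and n :: nat
    and f :: "(nat \<Rightarrow> 'x) \<Rightarrow> real"
    and p :: real
    and V A :: "nat \<Rightarrow> real"
    and x :: real
  assumes "infinite_memory_chain M \<epsilon> F a past X"
    and "n \<ge> 1"
    and "separately_Lipschitz n f"
    and "\<And>m z y y'. m \<ge> 1 \<Longrightarrow> dist (F m z y) (F m z y') \<le> dist y y'"
    and "p \<ge> 2"
    and "\<And>k. k \<in> {1..n} \<Longrightarrow> V k > 0"
    and "\<And>k. k \<in> {1..n} \<Longrightarrow> A k > 0"
    and "\<And>k. k \<in> {1..n} \<Longrightarrow>
      (\<integral>\<^sup>+\<omega>. (mean_dist (distr M borel (\<epsilon> k)) (\<epsilon> k \<omega>))\<^sup>2 \<partial>M) \<le> ennreal (V k)"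
    and "\<And>k. k \<in> {1..n} \<Longrightarrow>
      (\<integral>\<^sup>+\<omega>. ennreal_powr (mean_dist (distr M borel (\<epsilon> k)) (\<epsilon> k \<omega>)) p \<partial>M) \<le> ennreal (A k)"
    and "x > 0"
  shows "let V_tot = (\<Sum>k=1..n. (diag_coeff a (n - k))\<^sup>2 * V k);
             A_tot = (\<Sum>k=1..n. diag_coeff a (n - k) powr p * A k)
         in measure M {\<omega> \<in> space M. \<bar>centered_functional M n f X \<omega>\<bar> \<ge> x}
              \<le> 2 * (1 + 2 / p) powr p * (A_tot / x powr p)
                + 2 * exp (- (2 / ((p + 2)\<^sup>2 * exp p) * (x\<^sup>2 / V_tot)))"
proof -
  interpret infinite_memory_chain M \<epsilon> F a past X by fact
  have \<epsilon>: "\<epsilon> k \<in> M \<rightarrow>\<^sub>M borel" if "k \<in> {1..n}" for k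
    using indep_innovations that by (simp add: indep_vars_def)
  \<comment> \<open>The second moment bound makes the mean distance finite at almost every value of
    the innovation, hence somewhere, and the triangle inequality spreads this to every
    \<open>y\<close>.\<close>
  have finite: "mean_dist (distr M borel (\<epsilon> k)) y < \<infinity>" if k: "k \<in> {1..n}" for k y
  proof -
    note [measurable] = \<epsilon>[OF k]
    let ?P = "distr M borel (\<epsilon> k)"
    interpret P: prob_space ?P by (rule prob_space_distr) measurable
    have [measurable]: "mean_dist ?P \<in> borel_measurable borel"
      by (intro measurable_mean_dist P.sigma_finite_measure_axioms) simp
    have "(\<integral>\<^sup>+\<omega>. (mean_dist ?P (\<epsilon> k \<omega>))\<^sup>2 \<partial>M) \<noteq> \<infinity>"
      using assms(8)[OF k] by (auto simp: top_unique)
    then have "AE \<omega> in M. (mean_dist ?P (\<epsilon> k \<omega>))\<^sup>2 \<noteq> \<infinity>"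
      by (intro nn_integral_PInf_AE) measurable
    then have "\<exists>\<omega>. (mean_dist ?P (\<epsilon> k \<omega>))\<^sup>2 \<noteq> \<infinity>"
      by (rule contrapos_pp) (simp add: AE_False)
    then obtain \<omega> where "(mean_dist ?P (\<epsilon> k \<omega>))\<^sup>2 \<noteq> \<infinity>" by blast
    then have "mean_dist ?P (\<epsilon> k \<omega>) \<noteq> \<infinity>" by (auto simp: ennreal_mult_top power2_eq_square)
    then obtain z where "mean_dist ?P z < \<infinity>" by (auto simp: less_top)
    moreover have "mean_dist ?P y \<le> ennreal (dist y z) + mean_dist ?P z"
      by (rule mean_dist_triangle) (simp_all add: P.prob_space_axioms)
    ultimately show ?thesis by (simp add: le_less_trans ennreal_add_less_top)
  qed
  interpret lipschitz_memory_chain M \<epsilon> F a past X n f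
    using assms(3,4) finite by unfold_locales auto
  have indep: "indep_vars (\<lambda>_. borel) \<epsilon> {1..n}"
    using indep_innovations by (rule indep_vars_subset) auto
  \<comment> \<open>Treats the square and the p-th power at once: \<open>\<phi>\<close> is
    multiplicative, so the Lipschitz coefficient factors out, and \<open>\<Phi>\<close> is its
    \<open>ennreal\<close> counterpart, matching it because the mean distance is finite.\<close>
  have moment: "(\<integral>\<^sup>+\<omega>. ennreal (\<phi> (increment_bound k (\<epsilon> k \<omega>))) \<partial>M) \<le> ennreal (\<phi> (diag_coeff a (n - k)) * B)"
    if k: "k \<in> {1..n}" and B: "0 < B" "(\<integral>\<^sup>+\<omega>. \<Phi> (mean_dist (law k) (\<epsilon> k \<omega>)) \<partial>M) \<le> ennreal B"
      and [measurable]: "\<phi> \<in> borel_measurable borel"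
      and \<phi>: "\<And>t. 0 \<le> \<phi> t" "\<And>s t. 0 \<le> s \<Longrightarrow> 0 \<le> t \<Longrightarrow> \<phi> (s * t) = \<phi> s * \<phi> t"
      and \<Phi>: "\<And>t. 0 \<le> t \<Longrightarrow> \<Phi> (ennreal t) = ennreal (\<phi> t)"
    for k B and \<phi> :: "real \<Rightarrow> real" and \<Phi> :: "ennreal \<Rightarrow> ennreal"
  proof -
    let ?b = "diag_coeff a (n - k)" and ?G = "\<lambda>\<omega>. mean_dist (law k) (\<epsilon> k \<omega>)"
    interpret P: prob_space "law k" using k by (intro law_prob_space) simp
    have [measurable]: "mean_dist (law k) \<in> borel_measurable borel"
      by (intro measurable_mean_dist P.sigma_finite_measure_axioms) simp
    note [measurable] = \<epsilon>[OF k]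
    have "(\<integral>\<^sup>+\<omega>. ennreal (\<phi> (increment_bound k (\<epsilon> k \<omega>))) \<partial>M)
        = (\<integral>\<^sup>+\<omega>. ennreal (\<phi> ?b) * ennreal (\<phi> (enn2real (?G \<omega>))) \<partial>M)"
      using less_imp_le[OF diag_coeff_pos[of "n - k"]]
      by (simp add: increment_bound_def \<phi> ennreal_mult)
    also have "\<dots> = ennreal (\<phi> ?b) * (\<integral>\<^sup>+\<omega>. ennreal (\<phi> (enn2real (?G \<omega>))) \<partial>M)"
      by (intro nn_integral_cmult) measurable
    also have "(\<integral>\<^sup>+\<omega>. ennreal (\<phi> (enn2real (?G \<omega>))) \<partial>M) = (\<integral>\<^sup>+\<omega>. \<Phi> (?G \<omega>) \<partial>M)"
    proof (intro nn_integral_cong)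
      fix \<omega>
      have "?G \<omega> = ennreal (enn2real (?G \<omega>))"
        using finite[OF k] by simp
      then show "ennreal (\<phi> (enn2real (?G \<omega>))) = \<Phi> (?G \<omega>)"
        using \<Phi>[OF enn2real_nonneg, of "?G \<omega>"] by simp
    qed
    also have "ennreal (\<phi> ?b) * \<dots> \<le> ennreal (\<phi> ?b) * ennreal B"
      using B(2) by (intro mult_left_mono) auto
    finally show ?thesis using B(1) \<phi>(1) by (simp add: ennreal_mult)
  qed
  have sq: "(\<integral>\<^sup>+\<omega>. ennreal ((increment_bound k (\<epsilon> k \<omega>))\<^sup>2) \<partial>M) \<le> ennreal ((diag_coeff a (n - k))\<^sup>2 * V k)"
    if k: "k \<in> {1..n}" for k
    using assms(6,8)[OF k] by (rule moment[OF k]) (simp_all add: power_mult_distrib ennreal_power)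
  have pow: "(\<integral>\<^sup>+\<omega>. ennreal (increment_bound k (\<epsilon> k \<omega>) powr p) \<partial>M) \<le> ennreal (diag_coeff a (n - k) powr p * A k)"
    if k: "k \<in> {1..n}" for k
    using assms(7,9)[OF k] by (rule moment[OF k]) (simp_all add: powr_mult ennreal_powr_def)
  have int: "integrable M (\<lambda>\<omega>. increment_bound k (\<epsilon> k \<omega>))" if k: "k \<in> {1..n}" for k
  proof -
    have [measurable]: "(\<lambda>\<omega>. increment_bound k (\<epsilon> k \<omega>)) \<in> borel_measurable M"
      by (rule measurable_compose[OF \<epsilon> increment_bound_measurable]) (rule k)+
    have "integrable M (\<lambda>\<omega>. (increment_bound k (\<epsilon> k \<omega>))\<^sup>2)"
      using le_less_trans[OF sq[OF k]] by (intro integrableI_nonneg) auto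
    then show ?thesis by (rule square_integrable_imp_integrable[rotated]) measurable
  qed
  have "prob {\<omega> \<in> space M. x \<le> \<bar>centered_functional M n f X \<omega>\<bar>}
      = prob {\<omega> \<in> space M. x \<le> \<bar>\<Sum>k=1..n. increment k (\<lambda>j\<in>{1..<k}. \<epsilon> j \<omega>) (\<epsilon> k \<omega>)\<bar>}"
    using centered_functional_eq_sum[OF int] by (intro arg_cong[where f = prob] Collect_cong) auto
  also have "\<dots> \<le> 2 * (1 + 2 / p) powr p * ((\<Sum>k=1..n. diag_coeff a (n - k) powr p * A k) / x powr p)
      + 2 * exp (- (2 / ((p + 2)\<^sup>2 * exp p) * (x\<^sup>2 / (\<Sum>k=1..n. (diag_coeff a (n - k))\<^sup>2 * V k))))"
    using assms(2,5,6,7,10)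
    by (intro fuk_nagaev[OF indep, where \<eta> = increment_bound] increment_measurable increment_bound_measurable increment_le
        increment_centered sq pow) (auto simp: less_imp_neq[OF diag_coeff_pos, symmetric])
  finally show ?thesis by (simp add: Let_def)
qed

end
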